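(* The $\mathbb{C}$-algebra $\mathcal{E}_3(1)$ is semisimple, and $$\mathcal{E}_3(1)\cong 4M_1(\mathbb{C})\oplus 2M_2(\mathbb{C})\oplus 2M_3(\mathbb{C}),$$ where $kM_d(\mathbb{C})$ denotes the direct sum of $k$ copies of the algebra $M_d(\mathbb{C})$ of $d\times d$ complex matrices.
   Context: $\mathcal{E}_3(1)$ is the specialization at $u=1$ of the algebra of braids and ties $\mathcal{E}_3(u)$: it is the associative unital $\mathbb{C}$-algebra with generators $1,T_1,T_2,E_1,E_2$ and relations (for $i,j\in\{1,2\}$): - $T_1T_2T_1=T_2T_1T_2$; - $E_i^2=E_i$; - $E_1E_2=E_2E_1$; - $E_iT_i=T_iE_i$; - $E_jT_iT_j=T_iT_jE_i$ if $i\ne j$; - $E_iE_jT_j=E_iT_jE_i=T_jE_iE_j$ if $i\ne j$; - $T_i^2=1$. *)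

theory Defs
  imports
    "HOL-Library.Poly_Mapping"
    "HOL-Algebra.QuotRing"
    "HOL-Algebra.Chinese_Remainder"
    "Jordan_Normal_Form.Matrix"
begin

section \<open>Algebras as records\<close>

text \<open>
  A complex algebra is a record of type \<open>(complex, 'a) module\<close>: a ring together with a scalar
  multiplication.  (The locale \<open>algebra\<close> of the library is restricted to commutative algebras.)
\<close>

definition alg_iso ::
  "(complex, 'a, 'm) module_scheme \<Rightarrow> (complex, 'b, 'n) module_scheme \<Rightarrow> ('a \<Rightarrow> 'b) set" where
  "alg_iso A B = {h \<in> ring_iso A B.
     \<forall>c. \<forall>x\<in>carrier A. h (c \<odot>\<^bsub>A\<^esub> x) = c \<odot>\<^bsub>B\<^esub> h x}"

definition alg_isomorphic ::
  "(complex, 'a, 'm) module_scheme \<Rightarrow> (complex, 'b, 'n) module_scheme \<Rightarrow> bool" where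
  "alg_isomorphic A B \<longleftrightarrow> alg_iso A B \<noteq> {}"

definition quotient_alg ::
  "(complex, 'a, 'm) module_scheme \<Rightarrow> 'a set \<Rightarrow> (complex, 'a set) module" where
  "quotient_alg A I = ring.extend (A Quot I)
     (module.fields (\<lambda>c X. \<Union>x\<in>X. I +>\<^bsub>A\<^esub> (c \<odot>\<^bsub>A\<^esub> x)))"

definition direct_sum_alg ::
  "(complex, 'a, 'm) module_scheme list \<Rightarrow> (complex, 'a list) module" where
  "direct_sum_alg As = ring.extend (RDirProd_list As)
     (module.fields (\<lambda>c xs. map2 (\<lambda>A x. c \<odot>\<^bsub>A\<^esub> x) As xs))"

abbreviation matrix_alg :: "nat \<Rightarrow> (complex, complex mat) module" where
  "matrix_alg d \<equiv> module_mat TYPE(complex) d d"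


section \<open>Semisimplicity\<close>

definition left_ideal :: "('a, 'm) ring_scheme \<Rightarrow> 'a set \<Rightarrow> bool" where
  "left_ideal R L \<longleftrightarrow>
     additive_subgroup L R \<and> (\<forall>a\<in>carrier R. \<forall>x\<in>L. a \<otimes>\<^bsub>R\<^esub> x \<in> L)"

text \<open>The left ideals are the submodules of the left regular module, and the minimal ones are
  its simple submodules.\<close>

definition minimal_left_ideal :: "('a, 'm) ring_scheme \<Rightarrow> 'a set \<Rightarrow> bool" where
  "minimal_left_ideal R L \<longleftrightarrow> left_ideal R L \<and> L \<noteq> {\<zero>\<^bsub>R\<^esub>} \<and>
     (\<forall>L'. left_ideal R L' \<and> L' \<subseteq> L \<longrightarrow> L' = {\<zero>\<^bsub>R\<^esub>} \<or> L' = L)"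

text \<open>
  A unital ring is semisimple if its left regular module is a direct sum of simple submodules.
  Finitely many summands suffice, since the unit lies in the sum of finitely many of them.
\<close>

definition semisimple_ring :: "('a, 'm) ring_scheme \<Rightarrow> bool" where
  "semisimple_ring R \<longleftrightarrow> ring R \<and>
     (\<exists>(n::nat) L. (\<forall>i<n. minimal_left_ideal R (L i)) \<and>
        (\<forall>x\<in>carrier R. \<exists>!f. f \<in> (\<Pi>\<^sub>E i\<in>{..<n}. L i) \<and> x = (\<Oplus>\<^bsub>R\<^esub>i\<in>{..<n}. f i)))"


section \<open>Free algebras\<close>

text \<open>
  Words form a monoid under concatenation, written additively because the convolution product of
  \<^typ>\<open>'a \<Rightarrow>\<^sub>0 'b\<close> is defined for additive monoids \<open>'a\<close>.
\<close>

instantiation list :: (type) monoid_add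
begin

definition zero_list :: "'a list" where "zero_list = []"
definition plus_list :: "'a list \<Rightarrow> 'a list \<Rightarrow> 'a list" where "plus_list = (@)"

instance by standard (simp_all add: zero_list_def plus_list_def)

end

definition free_alg :: "(complex, 'g list \<Rightarrow>\<^sub>0 complex) module" where
  "free_alg = \<lparr>carrier = UNIV, monoid.mult = (*), one = 1, zero = 0, add = (+),
     module.smult = (\<lambda>c p. Poly_Mapping.map ((*) c) p)\<rparr>"

definition gen :: "'g \<Rightarrow> 'g list \<Rightarrow>\<^sub>0 complex" where
  "gen g = Poly_Mapping.single [g] 1"

lemma ring_free_alg: "ring (free_alg :: (complex, 'g list \<Rightarrow>\<^sub>0 complex) module)"
proof (rule ringI)
  show "abelian_group (free_alg :: (complex, 'g list \<Rightarrow>\<^sub>0 complex) module)"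
    by (rule abelian_groupI)
      (auto simp: free_alg_def algebra_simps intro: exI[of _ "- _"] left_minus)
  show "Group.monoid (free_alg :: (complex, 'g list \<Rightarrow>\<^sub>0 complex) module)"
    by (rule monoidI) (auto simp: free_alg_def algebra_simps)
qed (auto simp: free_alg_def algebra_simps)


section \<open>The algebra of braids and ties on three strands at parameter 1\<close>

datatype index = I1 | I2

datatype bt_gen = Tgen index | Egen index

abbreviation genT :: "index \<Rightarrow> bt_gen list \<Rightarrow>\<^sub>0 complex" where "genT i \<equiv> gen (Tgen i)"
abbreviation genE :: "index \<Rightarrow> bt_gen list \<Rightarrow>\<^sub>0 complex" where "genE i \<equiv> gen (Egen i)"

definition bt_relators :: "(bt_gen list \<Rightarrow>\<^sub>0 complex) set" where
  "bt_relators =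
     {genT I1 * genT I2 * genT I1 - genT I2 * genT I1 * genT I2}
   \<union> {genE i ^ 2 - genE i | i. True}
   \<union> {genE I1 * genE I2 - genE I2 * genE I1}
   \<union> {genE i * genT i - genT i * genE i | i. True}
   \<union> {genE j * genT i * genT j - genT i * genT j * genE i | i j. i \<noteq> j}
   \<union> {genE i * genE j * genT j - genE i * genT j * genE i | i j. i \<noteq> j}
   \<union> {genE i * genT j * genE i - genT j * genE i * genE j | i j. i \<noteq> j}
   \<union> {genT i ^ 2 - 1 | i. True}"

definition bt_ideal :: "(bt_gen list \<Rightarrow>\<^sub>0 complex) set" where
  "bt_ideal = Idl\<^bsub>free_alg\<^esub> bt_relators"

definition bt_alg :: "(complex, (bt_gen list \<Rightarrow>\<^sub>0 complex) set) module" where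
  "bt_alg = quotient_alg free_alg bt_ideal"

lemma ideal_bt_ideal: "ideal bt_ideal free_alg"
  unfolding bt_ideal_def
  by (rule ring.genideal_ideal[OF ring_free_alg]) (simp add: free_alg_def)

lemma ring_bt_alg: "ring bt_alg"
proof -
  interpret Q: ring "free_alg Quot bt_ideal"
    by (rule ideal.quotient_is_ring[OF ideal_bt_ideal])
  have sel: "carrier bt_alg = carrier (free_alg Quot bt_ideal)"
    "monoid.mult bt_alg = monoid.mult (free_alg Quot bt_ideal)"
    "one bt_alg = one (free_alg Quot bt_ideal)"
    "zero bt_alg = zero (free_alg Quot bt_ideal)"
    "add bt_alg = add (free_alg Quot bt_ideal)"
    by (simp_all add: bt_alg_def quotient_alg_def ring.defs module.defs)
  show ?thesis
  proof (rule ringI)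
    show "abelian_group bt_alg"
    proof (rule abelian_groupI, unfold sel)
      fix x assume "x \<in> carrier (free_alg Quot bt_ideal)"
      then show "\<exists>y\<in>carrier (free_alg Quot bt_ideal).
          y \<oplus>\<^bsub>free_alg Quot bt_ideal\<^esub> x = \<zero>\<^bsub>free_alg Quot bt_ideal\<^esub>"
        by (meson Q.a_inv_closed Q.l_neg)
    qed (simp_all add: Q.a_ac)
    show "Group.monoid bt_alg"
      by (rule monoidI, unfold sel) (simp_all add: Q.m_assoc)
  qed (simp_all add: sel Q.l_distr Q.r_distr)
qed

text \<open>Scalars act on representatives, so the union in \<^const>\<open>quotient_alg\<close> is a single coset.\<close>

lemma smult_bt_alg:
  "c \<odot>\<^bsub>bt_alg\<^esub> (bt_ideal +>\<^bsub>free_alg\<^esub> p) = bt_ideal +>\<^bsub>free_alg\<^esub> (c \<odot>\<^bsub>free_alg\<^esub> p)"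
proof -
  interpret I: ideal bt_ideal "free_alg :: (complex, bt_gen list \<Rightarrow>\<^sub>0 complex) module"
    by (rule ideal_bt_ideal)
  have smult: "d \<odot>\<^bsub>free_alg\<^esub> q = Poly_Mapping.single 0 d \<otimes>\<^bsub>free_alg\<^esub> q"
    for d and q :: "bt_gen list \<Rightarrow>\<^sub>0 complex"
    by (simp add: free_alg_def mult_map_scale_conv_mult)
  have car: "q \<in> carrier free_alg" for q :: "bt_gen list \<Rightarrow>\<^sub>0 complex"
    by (simp add: free_alg_def)
  have "bt_ideal +>\<^bsub>free_alg\<^esub> (c \<odot>\<^bsub>free_alg\<^esub> q) = bt_ideal +>\<^bsub>free_alg\<^esub> (c \<odot>\<^bsub>free_alg\<^esub> p)"
    if q: "q \<in> bt_ideal +>\<^bsub>free_alg\<^esub> p" for q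
  proof -
    obtain h where h: "h \<in> bt_ideal" "q = h \<oplus>\<^bsub>free_alg\<^esub> p"
      using q by (auto simp: a_r_coset_def')
    have "c \<odot>\<^bsub>free_alg\<^esub> q = c \<odot>\<^bsub>free_alg\<^esub> h \<oplus>\<^bsub>free_alg\<^esub> c \<odot>\<^bsub>free_alg\<^esub> p"
      unfolding smult h(2) by (simp add: I.r_distr car)
    moreover have "c \<odot>\<^bsub>free_alg\<^esub> h \<in> bt_ideal"
      unfolding smult by (rule I.I_l_closed) (simp_all add: h car)
    ultimately have "c \<odot>\<^bsub>free_alg\<^esub> q \<in> bt_ideal +>\<^bsub>free_alg\<^esub> (c \<odot>\<^bsub>free_alg\<^esub> p)"
      by (auto simp: a_r_coset_def')
    then show ?thesis
      using I.a_repr_independence[OF _ car I.a_subgroup] by simp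
  qed
  moreover have "p \<in> bt_ideal +>\<^bsub>free_alg\<^esub> p"
    by (rule I.a_rcos_self[OF car])
  ultimately have "(\<Union>q\<in>bt_ideal +>\<^bsub>free_alg\<^esub> p. bt_ideal +>\<^bsub>free_alg\<^esub> (c \<odot>\<^bsub>free_alg\<^esub> q))
      = bt_ideal +>\<^bsub>free_alg\<^esub> (c \<odot>\<^bsub>free_alg\<^esub> p)"
    by blast
  then show ?thesis
    by (simp only: bt_alg_def quotient_alg_def ring.defs module.defs module.simps)
qed

end

theory Submission
  imports Defs "HOL-Algebra.UnivPoly"
begin

text \<open>
  At \<open>u = 1\<close> the elements \<open>T\<^sub>1\<close>, \<open>T\<^sub>2\<close> generate a copy of the symmetric group \<open>S\<^sub>3\<close>.  The idempotents
  \<open>E\<^sub>1\<close>, \<open>E\<^sub>2\<close> and \<open>E\<^sub>3 = T\<^sub>2 E\<^sub>1 T\<^sub>2\<close> commute, are permuted by conjugation with \<open>S\<^sub>3\<close> like the three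
  partitions of three points into two blocks, and any two of them have the same product \<open>E\<close>.  The
  algebra is thus the smash product of \<open>S\<^sub>3\<close> with the semigroup algebra of the lattice of set
  partitions of three points under joins.  Moebius inversion splits this semigroup algebra into five
  copies of the complex numbers: \<open>S\<^sub>3\<close> fixes the idempotents \<open>E\<close> and
  \<open>1 - E\<^sub>1 - E\<^sub>2 - E\<^sub>3 + 2E\<close>, and permutes the three idempotents \<open>E\<^sub>i - E\<close> transitively.  Each fixed
  idempotent contributes the group algebra of \<open>S\<^sub>3\<close>, that is, two blocks of size 1 and one of
  size 2.  The orbit of size three contributes the 3 by 3 matrices over the group algebra of a
  stabilizer of order 2, that is, two blocks of size 3.

  The formal proof makes this decomposition explicit and needs no dimension count.  For each of the
  eight representations there is a \<open>seed\<close>, which in the algebra is a multiple of a primitive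
  idempotent of that block.  Its translates \<open>w\<^sub>i x\<close> under \<open>w\<^sub>0 = 1\<close>, \<open>w\<^sub>1 = T\<^sub>2\<close>, \<open>w\<^sub>2 = T\<^sub>1 T\<^sub>2\<close> span a left
  ideal on which every element acts through the matrices of the representation
  (\<open>orbit_vector_action\<close>), and a weighted sum of all \<open>w\<^sub>i x w\<^sub>i\<inverse>\<close> over all seeds \<open>x\<close> is the scalar 6
  (\<open>orbit_sum_total\<close>).  Multiplying this identity by an element that acts as zero in all eight
  representations shows that this element vanishes, so the joint representation is injective.  It is
  surjective because \<open>w\<^sub>i x w\<^sub>j\<inverse>\<close> acts as a nonzero multiple of a matrix unit in the representation of
  the seed \<open>x\<close> and as zero in all others (\<open>rep_matrix_unit\<close>).

  Semisimplicity then follows from the isomorphism: the diagonal matrix units form a complete system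
  of orthogonal idempotents \<open>e\<close> such that every nonzero \<open>x e\<close> can be multiplied back to \<open>e\<close>, and
  the left ideals generated by such a system decompose the regular module
  (\<open>semisimple_ring_of_minimal_idempotents\<close>).
\<close>

section \<open>Free algebras and their matrix representations\<close>

lemma free_alg_simps:
  "carrier free_alg = UNIV" "monoid.mult free_alg = (*)" "one free_alg = 1"
  "zero free_alg = 0" "add free_alg = (+)"
  "module.smult free_alg c p = Poly_Mapping.single 0 c * p"
  by (simp_all add: free_alg_def mult_map_scale_conv_mult)

lemma poly_mapping_add_induct [case_names single add]:
  fixes p :: "'a \<Rightarrow>\<^sub>0 'b::comm_monoid_add"
  assumes "\<And>w c. P (Poly_Mapping.single w c)" and "\<And>p q. P p \<Longrightarrow> P q \<Longrightarrow> P (p + q)"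
  shows "P p"
proof (induction p rule: Poly_Mapping.update_induct)
  case const
  show ?case using assms(1)[of _ 0] by simp
next
  case (update f a b)
  have "Poly_Mapping.update a b f = Poly_Mapping.single a b + f"
    using update(1)
    by (intro poly_mapping_eqI)
      (auto simp: lookup_update lookup_add lookup_single when_def in_keys_iff)
  then show ?case using assms update by simp
qed

text \<open>
  A single word is a product of generators, so a property that respects sums and products only has to
  be checked on scalars and on generators.
\<close>

lemma free_alg_induct [case_names const gen add mult]:
  fixes p :: "'g list \<Rightarrow>\<^sub>0 complex"
  assumes const: "\<And>c. P (Poly_Mapping.single 0 c)" and gen: "\<And>g. P (gen g)"
    and add: "\<And>p q. P p \<Longrightarrow> P q \<Longrightarrow> P (p + q)" and mult: "\<And>p q. P p \<Longrightarrow> P q \<Longrightarrow> P (p * q)"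
  shows "P p"
proof (induction p rule: poly_mapping_add_induct)
  case (single w c)
  show ?case
  proof (induction w)
    case Nil
    show ?case using const[of c] by (simp add: zero_list_def)
  next
    case (Cons g w)
    have "Poly_Mapping.single (g # w) c = gen g * Poly_Mapping.single w c"
      by (simp add: gen_def mult_single plus_list_def)
    then show ?case using gen mult Cons by simp
  qed
qed (rule add)

definition word_mat :: "nat \<Rightarrow> ('g \<Rightarrow> complex mat) \<Rightarrow> 'g list \<Rightarrow> complex mat" where
  "word_mat d M w = foldr (\<lambda>g A. M g * A) w (1\<^sub>m d)"

text \<open>
  The extension of an assignment of matrices to the generators to an algebra homomorphism on the free
  algebra.  It is built entrywise because matrices of unspecified size have no common zero and
  hence no sums over sets.
\<close>

definition matrix_rep ::
  "nat \<Rightarrow> ('g \<Rightarrow> complex mat) \<Rightarrow> ('g list \<Rightarrow>\<^sub>0 complex) \<Rightarrow> complex mat" where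
  "matrix_rep d M p =
     mat d d (\<lambda>ij. \<Sum>w\<in>Poly_Mapping.keys p. Poly_Mapping.lookup p w * word_mat d M w $$ ij)"

lemma matrix_rep_carrier [simp]: "matrix_rep d M p \<in> carrier_mat d d"
  by (simp add: matrix_rep_def)

lemma matrix_rep_dim [simp]: "dim_row (matrix_rep d M p) = d" "dim_col (matrix_rep d M p) = d"
  by (simp_all add: matrix_rep_def)

lemma matrix_rep_add: "matrix_rep d M (p + q) = matrix_rep d M p + matrix_rep d M q"
proof -
  let ?S = "Poly_Mapping.keys p \<union> Poly_Mapping.keys q"
  have "(\<Sum>w\<in>Poly_Mapping.keys r. Poly_Mapping.lookup r w * word_mat d M w $$ ij)
      = (\<Sum>w\<in>?S. Poly_Mapping.lookup r w * word_mat d M w $$ ij)"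
    if "Poly_Mapping.keys r \<subseteq> ?S" for r :: "'a list \<Rightarrow>\<^sub>0 complex" and ij
    using that by (intro sum.mono_neutral_left) (auto simp: in_keys_iff)
  note * = this
  have "(\<Sum>w\<in>Poly_Mapping.keys (p + q). Poly_Mapping.lookup (p + q) w * word_mat d M w $$ ij) =
      (\<Sum>w\<in>Poly_Mapping.keys p. Poly_Mapping.lookup p w * word_mat d M w $$ ij) +
      (\<Sum>w\<in>Poly_Mapping.keys q. Poly_Mapping.lookup q w * word_mat d M w $$ ij)" for ij
    unfolding *[OF Un_upper1] *[OF Un_upper2] *[OF Poly_Mapping.keys_add]
    by (simp add: lookup_add distrib_right sum.distrib)
  then show ?thesis by (intro eq_matI) (simp_all add: matrix_rep_def)
qed

context
  fixes d :: nat and M :: "'g \<Rightarrow> complex mat"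
  assumes carrier: "\<And>g. M g \<in> carrier_mat d d"
begin

lemma word_mat_carrier [simp]: "word_mat d M w \<in> carrier_mat d d"
proof (induction w)
  case (Cons g w)
  have "M g * word_mat d M w \<in> carrier_mat d d"
    by (rule mult_carrier_mat[OF carrier Cons])
  then show ?case by (simp add: word_mat_def)
qed (simp add: word_mat_def)

lemma word_mat_append: "word_mat d M (v @ w) = word_mat d M v * word_mat d M w"
proof (induction v)
  case Nil
  have "1\<^sub>m d * word_mat d M w = word_mat d M w"
    by (rule left_mult_one_mat[OF word_mat_carrier])
  then show ?case by (simp add: word_mat_def)
next
  case (Cons g v)
  have "M g * (word_mat d M v * word_mat d M w) = M g * word_mat d M v * word_mat d M w"
    by (rule assoc_mult_mat[OF carrier word_mat_carrier word_mat_carrier, symmetric])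
  with Cons show ?case by (simp add: word_mat_def)
qed

lemma matrix_rep_single: "matrix_rep d M (Poly_Mapping.single w c) = c \<cdot>\<^sub>m word_mat d M w"
  using word_mat_carrier[of w, THEN carrier_matD(1)] word_mat_carrier[of w, THEN carrier_matD(2)]
  by (intro eq_matI) (auto simp: matrix_rep_def)

lemma matrix_rep_mult: "matrix_rep d M (p * q) = matrix_rep d M p * matrix_rep d M q"
proof (induction p rule: poly_mapping_add_induct)
  case (single v a)
  show ?case
  proof (induction q rule: poly_mapping_add_induct)
    case (single w b)
    have "a \<cdot>\<^sub>m word_mat d M v * (b \<cdot>\<^sub>m word_mat d M w)
        = (a * b) \<cdot>\<^sub>m (word_mat d M v * word_mat d M w)"
      by (simp add: mult_smult_assoc_mat[of _ d d _ d] mult_smult_distrib[of _ d d _ d])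
        (simp add: mat_eq_iff)
    then show ?case
      by (simp add: mult_single matrix_rep_single plus_list_def word_mat_append)
  next
    case (add p q)
    then show ?case
      by (simp add: distrib_left matrix_rep_add mult_add_distrib_mat[of _ d d _ d])
  qed
next
  case (add p q)
  then show ?case
    by (simp add: distrib_right matrix_rep_add add_mult_distrib_mat[of _ d d _ _ d])
qed

lemma matrix_rep_const: "matrix_rep d M (Poly_Mapping.single 0 c) = c \<cdot>\<^sub>m 1\<^sub>m d"
  by (simp add: matrix_rep_single zero_list_def word_mat_def)

lemma matrix_rep_0: "matrix_rep d M 0 = 0\<^sub>m d d"
  using matrix_rep_const[of 0] by (simp add: mat_eq_iff)

lemma matrix_rep_1: "matrix_rep d M 1 = 1\<^sub>m d"
  using matrix_rep_const[of 1] by (simp add: mat_eq_iff)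

lemma matrix_rep_gen: "matrix_rep d M (gen g) = M g"
  using carrier[of g] by (simp add: gen_def matrix_rep_single word_mat_def mat_eq_iff)

lemma matrix_rep_uminus: "matrix_rep d M (- p) = - matrix_rep d M p"
proof -
  have "(matrix_rep d M p + matrix_rep d M (- p)) $$ ij = 0\<^sub>m d d $$ ij" for ij
    by (simp add: matrix_rep_0 flip: matrix_rep_add)
  then have "matrix_rep d M p $$ (i, j) + matrix_rep d M (- p) $$ (i, j) = 0"
    if "i < d" "j < d" for i j
    using that by (metis index_add_mat(1) index_zero_mat(1) matrix_rep_dim)
  then show ?thesis by (intro eq_matI) (simp_all add: eq_neg_iff_add_eq_0 add.commute)
qed

lemma matrix_rep_diff: "matrix_rep d M (p - q) = matrix_rep d M p - matrix_rep d M q"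
  using matrix_rep_add[of d M p "- q"]
  by (simp add: matrix_rep_uminus add_uminus_minus_mat[of _ d d])

lemma matrix_rep_sum:
  "finite I \<Longrightarrow> a < d \<Longrightarrow> b < d \<Longrightarrow>
    matrix_rep d M (\<Sum>i\<in>I. f i) $$ (a, b) = (\<Sum>i\<in>I. matrix_rep d M (f i) $$ (a, b))"
  by (induction I rule: finite_induct) (simp_all add: matrix_rep_0 matrix_rep_add)

end

section \<open>Semisimplicity from idempotents\<close>

text \<open>
  The last condition says that \<open>e i\<close> lies in every nonzero left ideal contained in \<open>R e i\<close>.
  Idempotence is a consequence: multiply the decomposition of the unit by \<open>e i\<close>.
\<close>

definition minimal_idempotents :: "('a, 'm) ring_scheme \<Rightarrow> 'i set \<Rightarrow> ('i \<Rightarrow> 'a) \<Rightarrow> bool" where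
  "minimal_idempotents R I e \<longleftrightarrow>
     e \<in> I \<rightarrow> carrier R - {\<zero>\<^bsub>R\<^esub>} \<and>
     (\<forall>i\<in>I. \<forall>j\<in>I. i \<noteq> j \<longrightarrow> e i \<otimes>\<^bsub>R\<^esub> e j = \<zero>\<^bsub>R\<^esub>) \<and>
     (\<Oplus>\<^bsub>R\<^esub>i\<in>I. e i) = \<one>\<^bsub>R\<^esub> \<and>
     (\<forall>i\<in>I. \<forall>x\<in>carrier R. x \<otimes>\<^bsub>R\<^esub> e i \<noteq> \<zero>\<^bsub>R\<^esub> \<longrightarrow> (\<exists>y\<in>carrier R. y \<otimes>\<^bsub>R\<^esub> (x \<otimes>\<^bsub>R\<^esub> e i) = e i))"

lemma (in ring) minimal_idempotents_idem:
  assumes "minimal_idempotents R I e" "finite I" "i \<in> I"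
  shows "e i \<otimes> e i = e i"
proof -
  have e: "e j \<in> carrier R" if "j \<in> I" for j
    using assms(1) that by (auto simp: minimal_idempotents_def)
  have "e i = e i \<otimes> (\<Oplus>j\<in>I. e j)"
    using assms e by (simp add: minimal_idempotents_def)
  also have "\<dots> = (\<Oplus>j\<in>I. e i \<otimes> e j)"
    using assms e by (intro finsum_rdistr) auto
  also have "\<dots> = (\<Oplus>j\<in>I. if i = j then e i \<otimes> e i else \<zero>)"
    using assms e by (intro finsum_cong') (auto simp: minimal_idempotents_def)
  also have "\<dots> = e i \<otimes> e i"
    using finsum_singleton[of i I "\<lambda>j. e i \<otimes> e i"] assms e by simp
  finally show ?thesis ..
qed

text \<open>
  A nonzero left ideal inside \<open>R u\<close> contains some \<open>x u \<noteq> 0\<close>, hence also \<open>u = y (x u)\<close>, hence all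
  of \<open>R u\<close>.
\<close>

lemma (in ring) minimal_left_ideal_idempotent:
  assumes "u \<in> carrier R" "u \<otimes> u = u" "u \<noteq> \<zero>"
    and "\<And>x. x \<in> carrier R \<Longrightarrow> x \<otimes> u \<noteq> \<zero> \<Longrightarrow> \<exists>y\<in>carrier R. y \<otimes> (x \<otimes> u) = u"
  shows "minimal_left_ideal R ((\<lambda>x. x \<otimes> u) ` carrier R)"
  unfolding minimal_left_ideal_def
proof (intro conjI allI impI)
  let ?L = "(\<lambda>x. x \<otimes> u) ` carrier R"
  have "additive_subgroup ?L R"
  proof (intro additive_subgroup.intro subgroup.intro)
    fix x assume "x \<in> ?L"
    then obtain a where a: "a \<in> carrier R" "x = a \<otimes> u" by auto
    then have "inv\<^bsub>add_monoid R\<^esub> x = (\<ominus> a) \<otimes> u"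
      using assms by (simp add: l_minus flip: a_inv_def)
    with a show "inv\<^bsub>add_monoid R\<^esub> x \<in> ?L" by auto
  next
    fix x y assume "x \<in> ?L" "y \<in> ?L"
    then obtain a b where "a \<in> carrier R" "x = a \<otimes> u" "b \<in> carrier R" "y = b \<otimes> u" by auto
    then have "x \<oplus> y = (a \<oplus> b) \<otimes> u" "a \<oplus> b \<in> carrier R"
      using assms by (simp_all add: l_distr)
    then show "x \<otimes>\<^bsub>add_monoid R\<^esub> y \<in> ?L" by auto
  next
    have "\<zero> = \<zero> \<otimes> u" using assms by simp
    then show "\<one>\<^bsub>add_monoid R\<^esub> \<in> ?L" by auto
  qed (use assms in auto)
  moreover have "a \<otimes> x \<in> ?L" if ax: "a \<in> carrier R" "x \<in> ?L" for a x
  proof -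
    obtain b where "b \<in> carrier R" "x = b \<otimes> u" using ax by auto
    then have "a \<otimes> x = (a \<otimes> b) \<otimes> u" "a \<otimes> b \<in> carrier R"
      using assms ax by (simp_all add: m_assoc)
    then show ?thesis by auto
  qed
  ultimately show "left_ideal R ?L" by (simp add: left_ideal_def)
  have "u \<in> ?L" using assms by force
  with assms show "?L \<noteq> {\<zero>}" by auto
  fix L' assume L': "left_ideal R L' \<and> L' \<subseteq> ?L"
  then interpret L': additive_subgroup L' R by (simp add: left_ideal_def)
  show "L' = {\<zero>} \<or> L' = ?L"
  proof (cases "L' = {\<zero>}")
    case False
    then obtain z where z: "z \<in> L'" "z \<noteq> \<zero>" using L'.zero_closed by blast
    then obtain x where "x \<in> carrier R" "z = x \<otimes> u" using L' by auto
    with assms(4)[of x] z obtain y where "y \<in> carrier R" "y \<otimes> z = u" by auto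
    with L' z have "u \<in> L'" by (force simp: left_ideal_def)
    with L' show ?thesis by (auto simp: left_ideal_def)
  qed simp
qed

text \<open>
  This is the Peirce decomposition \<open>x = \<Sum> x e i\<close>.  Its components are unique because right
  multiplication by \<open>e i\<close> kills all summands except the one in \<open>R e i\<close>, which it fixes.
\<close>

theorem (in ring) semisimple_ring_of_minimal_idempotents:
  assumes e: "minimal_idempotents R I e" and fin: "finite I"
  shows "semisimple_ring R"
proof -
  obtain b where b: "bij_betw b {..<card I} I"
    using ex_bij_betw_nat_finite[OF fin] by (auto simp: atLeast0LessThan)
  define u where "u i = e (b i)" for i
  define L where "L i = (\<lambda>x. x \<otimes> u i) ` carrier R" for i
  let ?N = "{..<card I}"
  have bI: "b i \<in> I" if "i \<in> ?N" for i using b that by (auto simp: bij_betw_def)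
  have u: "u i \<in> carrier R" "u i \<noteq> \<zero>" if "i \<in> ?N" for i
    using e bI[OF that] by (auto simp: minimal_idempotents_def u_def)
  have idem: "u i \<otimes> u i = u i" if "i \<in> ?N" for i
    using minimal_idempotents_idem[OF e fin bI[OF that]] by (simp add: u_def)
  have orth: "u i \<otimes> u j = \<zero>" if "i \<in> ?N" "j \<in> ?N" "i \<noteq> j" for i j
  proof -
    have "b i \<noteq> b j" using b that by (auto simp: bij_betw_def inj_on_def)
    then show ?thesis using e bI that by (auto simp: minimal_idempotents_def u_def)
  qed
  have one: "(\<Oplus>i\<in>?N. u i) = \<one>"
  proof -
    have "(\<Oplus>i\<in>?N. e (b i)) = (\<Oplus>i\<in>b ` ?N. e i)"
      using b e bI by (intro finsum_reindex[symmetric]) (auto simp: bij_betw_def minimal_idempotents_def)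
    with b e show ?thesis by (simp add: u_def bij_betw_def minimal_idempotents_def)
  qed
  have "minimal_left_ideal R (L i)" if "i < card I" for i
    unfolding L_def
    using u[of i] idem[of i] e bI[of i] that
    by (intro minimal_left_ideal_idempotent) (auto simp: minimal_idempotents_def u_def)
  moreover have "\<exists>!f. f \<in> (\<Pi>\<^sub>E i\<in>?N. L i) \<and> x = (\<Oplus>i\<in>?N. f i)" if x: "x \<in> carrier R" for x
  proof (rule ex1I[of _ "\<lambda>i\<in>?N. x \<otimes> u i"], intro conjI)
    show "(\<lambda>i\<in>?N. x \<otimes> u i) \<in> (\<Pi>\<^sub>E i\<in>?N. L i)" using x by (auto simp: L_def)
    have "x = x \<otimes> (\<Oplus>i\<in>?N. u i)" using x one by simp
    also have "\<dots> = (\<Oplus>i\<in>?N. x \<otimes> u i)" using x u by (intro finsum_rdistr) auto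
    also have "\<dots> = (\<Oplus>i\<in>?N. (\<lambda>i\<in>?N. x \<otimes> u i) i)" using x u by (intro finsum_cong') auto
    finally show "x = (\<Oplus>i\<in>?N. (\<lambda>i\<in>?N. x \<otimes> u i) i)" .
  next
    fix f assume f: "f \<in> (\<Pi>\<^sub>E i\<in>?N. L i) \<and> x = (\<Oplus>i\<in>?N. f i)"
    have fu: "f i \<in> carrier R" "f i \<otimes> u j = (if i = j then f i else \<zero>)"
      if "i \<in> ?N" "j \<in> ?N" for i j
    proof -
      obtain a where "a \<in> carrier R" "f i = a \<otimes> u i"
        using f \<open>i \<in> ?N\<close> by (auto simp: L_def PiE_iff)
      then show "f i \<in> carrier R" "f i \<otimes> u j = (if i = j then f i else \<zero>)"
        using u that idem orth by (auto simp: m_assoc)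
    qed
    have "x \<otimes> u i = f i" if i: "i \<in> ?N" for i
    proof -
      have "x \<otimes> u i = (\<Oplus>j\<in>?N. f j \<otimes> u i)"
        using f fu(1)[OF _ i] u[OF i] by (simp add: finsum_ldistr)
      also have "\<dots> = (\<Oplus>j\<in>?N. if i = j then f j else \<zero>)"
        using fu i by (intro finsum_cong') auto
      also have "\<dots> = f i"
        using i fu(1)[OF _ i] by (intro finsum_singleton) auto
      finally show ?thesis .
    qed
    then show "f = (\<lambda>i\<in>?N. x \<otimes> u i)"
      using f by (auto simp: fun_eq_iff PiE_iff extensional_def)
  qed
  ultimately show ?thesis
    unfolding semisimple_ring_def
    by (intro conjI ring_axioms exI[of _ "card I"] exI[of _ L]) auto
qed

lemma minimal_idempotents_iso:
  assumes "ring R" "ring S" and g: "g \<in> ring_iso R S" and e: "minimal_idempotents R I e"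
  shows "minimal_idempotents S I (g \<circ> e)"
proof -
  interpret R: ring R by fact
  interpret S: ring S by fact
  have hom: "g \<in> Ring.ring_hom R S" and bij: "bij_betw g (carrier R) (carrier S)"
    using g by (auto simp: ring_iso_def)
  interpret g: ring_hom_ring R S g
    by (rule ring_hom_ringI2) (use hom in \<open>auto intro: R.ring_axioms S.ring_axioms\<close>)
  have eR: "e i \<in> carrier R" "e i \<noteq> \<zero>\<^bsub>R\<^esub>" if "i \<in> I" for i
    using e that by (auto simp: minimal_idempotents_def)
  have zero: "g x = \<zero>\<^bsub>S\<^esub> \<longleftrightarrow> x = \<zero>\<^bsub>R\<^esub>" if "x \<in> carrier R" for x
    using bij that by (metis R.zero_closed bij_betw_def g.hom_zero inj_onD)
  have "(\<Oplus>\<^bsub>S\<^esub>i\<in>I. g (e i)) = \<one>\<^bsub>S\<^esub>"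
    using e eR g.hom_finsum[of e I] by (auto simp: minimal_idempotents_def comp_def)
  moreover have "g (e i) \<otimes>\<^bsub>S\<^esub> g (e j) = \<zero>\<^bsub>S\<^esub>" if "i \<in> I" "j \<in> I" "i \<noteq> j" for i j
    using e eR that by (simp add: minimal_idempotents_def flip: g.hom_mult)
  moreover have "\<exists>y\<in>carrier S. y \<otimes>\<^bsub>S\<^esub> (x \<otimes>\<^bsub>S\<^esub> g (e i)) = g (e i)"
    if i: "i \<in> I" and x: "x \<in> carrier S" "x \<otimes>\<^bsub>S\<^esub> g (e i) \<noteq> \<zero>\<^bsub>S\<^esub>" for i x
  proof -
    obtain x' where x': "x' \<in> carrier R" "x = g x'"
      using bij x by (auto simp: bij_betw_def)
    then have "x' \<otimes>\<^bsub>R\<^esub> e i \<noteq> \<zero>\<^bsub>R\<^esub>"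
      using x eR[OF i] by (auto simp flip: g.hom_mult)
    then obtain y where "y \<in> carrier R" "y \<otimes>\<^bsub>R\<^esub> (x' \<otimes>\<^bsub>R\<^esub> e i) = e i"
      using e x' i unfolding minimal_idempotents_def by meson
    then show ?thesis
      using x' eR[OF i] by (intro bexI[of _ "g y"]) (simp_all flip: g.hom_mult)
  qed
  ultimately show ?thesis
    using eR by (auto simp: minimal_idempotents_def zero)
qed

section \<open>Direct sums of matrix algebras\<close>

lemma RDirProd_list_Cons_ops:
  assumes "x \<in> carrier R" "y \<in> carrier R"
    and "xs \<in> carrier (RDirProd_list Rs)" "ys \<in> carrier (RDirProd_list Rs)"
  shows "(x # xs) \<otimes>\<^bsub>RDirProd_list (R # Rs)\<^esub> (y # ys) = (x \<otimes>\<^bsub>R\<^esub> y) # (xs \<otimes>\<^bsub>RDirProd_list Rs\<^esub> ys)"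
    and "(x # xs) \<oplus>\<^bsub>RDirProd_list (R # Rs)\<^esub> (y # ys) = (x \<oplus>\<^bsub>R\<^esub> y) # (xs \<oplus>\<^bsub>RDirProd_list Rs\<^esub> ys)"
proof -
  let ?P = "RDirProd R (RDirProd_list Rs)"
  note hom = RDirProd_list_hom1[of R Rs]
  have "(x, xs) \<in> carrier ?P" "(y, ys) \<in> carrier ?P"
    using assms by (simp_all add: RDirProd_carrier)
  from ring_hom_mult[OF hom this] ring_hom_add[OF hom this]
  show "(x # xs) \<otimes>\<^bsub>RDirProd_list (R # Rs)\<^esub> (y # ys) = (x \<otimes>\<^bsub>R\<^esub> y) # (xs \<otimes>\<^bsub>RDirProd_list Rs\<^esub> ys)"
    and "(x # xs) \<oplus>\<^bsub>RDirProd_list (R # Rs)\<^esub> (y # ys) = (x \<oplus>\<^bsub>R\<^esub> y) # (xs \<oplus>\<^bsub>RDirProd_list Rs\<^esub> ys)"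
    by (simp_all add: RDirProd_def DirProd_def monoid.defs)
qed

lemma RDirProd_list_ops:
  assumes "xs \<in> carrier (RDirProd_list Rs)" "ys \<in> carrier (RDirProd_list Rs)"
  shows "xs \<otimes>\<^bsub>RDirProd_list Rs\<^esub> ys = map (\<lambda>(R, x, y). x \<otimes>\<^bsub>R\<^esub> y) (zip Rs (zip xs ys))"
    and "xs \<oplus>\<^bsub>RDirProd_list Rs\<^esub> ys = map (\<lambda>(R, x, y). x \<oplus>\<^bsub>R\<^esub> y) (zip Rs (zip xs ys))"
  using assms
  by (induction Rs arbitrary: xs ys)
    (auto simp: RDirProd_list_carrier RDirProd_list_Cons_ops monoid.defs)

definition matrix_sum :: "nat list \<Rightarrow> (complex, complex mat list) module" where
  "matrix_sum ds = direct_sum_alg (map matrix_alg ds)"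

lemma matrix_sum_sel:
  "carrier (matrix_sum ds) = carrier (RDirProd_list (map matrix_alg ds))"
  "monoid.mult (matrix_sum ds) = monoid.mult (RDirProd_list (map matrix_alg ds))"
  "add (matrix_sum ds) = add (RDirProd_list (map matrix_alg ds))"
  "one (matrix_sum ds) = one (RDirProd_list (map matrix_alg ds))"
  "zero (matrix_sum ds) = zero (RDirProd_list (map matrix_alg ds))"
  "module.smult (matrix_sum ds) c xs = map2 (\<lambda>A x. c \<odot>\<^bsub>A\<^esub> x) (map matrix_alg ds) xs"
  by (simp_all add: matrix_sum_def direct_sum_alg_def ring.defs module.defs)

lemma matrix_sum_carrier:
  "xs \<in> carrier (matrix_sum ds) \<longleftrightarrow>
    length xs = length ds \<and> (\<forall>k<length ds. xs ! k \<in> carrier_mat (ds ! k) (ds ! k))"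
  unfolding matrix_sum_sel
  using RDirProd_list_carrier_mem[of xs "map matrix_alg ds"]
    RDirProd_list_carrier_memI[of xs "map matrix_alg ds"]
  by (auto simp: module_mat_simps)

lemma matrix_sum_ops:
  assumes "xs \<in> carrier (matrix_sum ds)" "ys \<in> carrier (matrix_sum ds)"
  shows "xs \<otimes>\<^bsub>matrix_sum ds\<^esub> ys = map2 (*) xs ys"
    and "xs \<oplus>\<^bsub>matrix_sum ds\<^esub> ys = map2 (+) xs ys"
  using assms
  by (auto simp: matrix_sum_carrier matrix_sum_sel RDirProd_list_ops module_mat_simps
      intro!: nth_equalityI) (auto simp: RDirProd_list_ops module_mat_simps matrix_sum_sel(1)[symmetric] matrix_sum_carrier)

lemma matrix_sum_units:
  "\<one>\<^bsub>matrix_sum ds\<^esub> = map 1\<^sub>m ds" "\<zero>\<^bsub>matrix_sum ds\<^esub> = map (\<lambda>d. 0\<^sub>m d d) ds"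
  unfolding matrix_sum_sel RDirProd_list_one RDirProd_list_zero
  by (induction ds) (simp_all add: module_mat_simps)

lemma matrix_sum_smult:
  "length xs = length ds \<Longrightarrow> c \<odot>\<^bsub>matrix_sum ds\<^esub> xs = map (\<lambda>x. c \<cdot>\<^sub>m x) xs"
  unfolding matrix_sum_sel
  by (intro nth_equalityI) (simp_all add: module_mat_simps)

lemma ring_matrix_alg: "ring (matrix_alg d)"
  by (unfold_locales, insert add_inv_exists_mat, auto simp: module_mat_def algebra_simps Units_def)

lemma ring_matrix_sum: "ring (matrix_sum ds)"
proof -
  let ?P = "RDirProd_list (map matrix_alg ds) :: complex mat list ring"
  interpret P: ring ?P
    by (rule RDirProd_list_is_ring) (simp add: ring_matrix_alg)
  show ?thesis
  proof (rule ringI)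
    show "abelian_group (matrix_sum ds)"
    proof (rule abelian_groupI, unfold matrix_sum_sel)
      fix x assume "x \<in> carrier (RDirProd_list (map matrix_alg ds))"
      then show "\<exists>y\<in>carrier (RDirProd_list (map matrix_alg ds)).
          y \<oplus>\<^bsub>RDirProd_list (map matrix_alg ds)\<^esub> x = \<zero>\<^bsub>RDirProd_list (map matrix_alg ds)\<^esub>"
        by (intro bexI[of _ "\<ominus>\<^bsub>?P\<^esub> x"]) (simp_all add: P.l_neg)
    qed (simp_all add: P.a_ac)
    show "Group.monoid (matrix_sum ds)"
      by (rule monoidI, unfold matrix_sum_sel) (simp_all add: P.m_assoc)
  qed (simp_all add: matrix_sum_sel P.l_distr P.r_distr)
qed

definition mat_unit :: "nat \<Rightarrow> nat \<Rightarrow> nat \<Rightarrow> complex mat" where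
  "mat_unit d i j = mat d d (\<lambda>ab. if ab = (i, j) then 1 else 0)"

lemma mat_unit_carrier [simp]: "mat_unit d i j \<in> carrier_mat d d"
  by (simp add: mat_unit_def)

lemma mat_unit_index [simp]:
  "a < d \<Longrightarrow> b < d \<Longrightarrow> mat_unit d i j $$ (a, b) = (if a = i \<and> b = j then 1 else 0)"
  "dim_row (mat_unit d i j) = d" "dim_col (mat_unit d i j) = d"
  by (simp_all add: mat_unit_def)

lemma mat_mult_unit_index:
  assumes "A \<in> carrier_mat d d" "a < d" "b < d" "i < d"
  shows "(A * mat_unit d i j) $$ (a, b) = (if b = j then A $$ (a, i) else 0)"
    and "(mat_unit d j i * A) $$ (a, b) = (if a = j then A $$ (i, b) else 0)"
proof -
  have "(\<Sum>l = 0..<d. A $$ (a, l) * mat_unit d i j $$ (l, b))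
      = (\<Sum>l = 0..<d. if l = i then if b = j then A $$ (a, l) else 0 else 0)"
    using assms by (intro sum.cong) auto
  then show "(A * mat_unit d i j) $$ (a, b) = (if b = j then A $$ (a, i) else 0)"
    using assms by (simp add: scalar_prod_def)
  have "(\<Sum>l = 0..<d. mat_unit d j i $$ (a, l) * A $$ (l, b))
      = (\<Sum>l = 0..<d. if l = i then if a = j then A $$ (l, b) else 0 else 0)"
    using assms by (intro sum.cong) auto
  then show "(mat_unit d j i * A) $$ (a, b) = (if a = j then A $$ (i, b) else 0)"
    using assms by (simp add: scalar_prod_def)
qed

lemma matrix_sum_finsum_index:
  assumes "finite I" "f \<in> I \<rightarrow> carrier (matrix_sum ds)" "k < length ds" "a < ds ! k" "b < ds ! k"
  shows "(\<Oplus>\<^bsub>matrix_sum ds\<^esub>i\<in>I. f i) ! k $$ (a, b) = (\<Sum>i\<in>I. f i ! k $$ (a, b))"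
proof -
  interpret ring "matrix_sum ds" by (rule ring_matrix_sum)
  show ?thesis
    using assms(1,2)
  proof (induction I rule: finite_induct)
    case empty
    then show ?case using assms by (simp add: matrix_sum_units)
  next
    case (insert i I)
    have s: "finsum (matrix_sum ds) f I \<in> carrier (matrix_sum ds)"
      using insert by (intro finsum_closed) auto
    have f: "f i \<in> carrier (matrix_sum ds)" using insert by auto
    have "length (finsum (matrix_sum ds) f I) = length ds" "length (f i) = length ds"
      "finsum (matrix_sum ds) f I ! k \<in> carrier_mat (ds ! k) (ds ! k)"
      using s f assms(3) unfolding matrix_sum_carrier by blast+
    then show ?case
      using insert assms s f by (simp add: matrix_sum_ops Pi_iff)
  qed
qed

definition block_mat :: "nat list \<Rightarrow> nat \<Rightarrow> complex mat \<Rightarrow> complex mat list" where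
  "block_mat ds k A = (map (\<lambda>d. 0\<^sub>m d d) ds)[k := A]"

lemma block_mat_nth:
  "k < length ds \<Longrightarrow> l < length ds \<Longrightarrow>
    block_mat ds k A ! l = (if l = k then A else 0\<^sub>m (ds ! l) (ds ! l))"
  by (simp add: block_mat_def)

lemma block_mat_carrier:
  "k < length ds \<Longrightarrow> A \<in> carrier_mat (ds ! k) (ds ! k) \<Longrightarrow>
    block_mat ds k A \<in> carrier (matrix_sum ds)"
  by (auto simp: matrix_sum_carrier block_mat_nth) (simp_all add: block_mat_def)

lemma mult_block_mat:
  assumes "xs \<in> carrier (matrix_sum ds)" "k < length ds" "A \<in> carrier_mat (ds ! k) (ds ! k)"
  shows "xs \<otimes>\<^bsub>matrix_sum ds\<^esub> block_mat ds k A = block_mat ds k (xs ! k * A)"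
proof (rule nth_equalityI)
  note c = assms(1)[unfolded matrix_sum_carrier]
  show "length (xs \<otimes>\<^bsub>matrix_sum ds\<^esub> block_mat ds k A) = length (block_mat ds k (xs ! k * A))"
    using assms block_mat_carrier[of k ds A] c by (simp add: matrix_sum_ops) (simp add: block_mat_def)
  fix l assume "l < length (xs \<otimes>\<^bsub>matrix_sum ds\<^esub> block_mat ds k A)"
  then have l: "l < length ds"
    using assms block_mat_carrier[of k ds A] c by (simp add: matrix_sum_ops)
  have "xs ! l * 0\<^sub>m (ds ! l) (ds ! l) = 0\<^sub>m (ds ! l) (ds ! l)"
    using c l by (intro right_mult_zero_mat) auto
  then show "(xs \<otimes>\<^bsub>matrix_sum ds\<^esub> block_mat ds k A) ! l = block_mat ds k (xs ! k * A) ! l"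
    using assms block_mat_carrier[of k ds A] c l
    by (simp add: matrix_sum_ops block_mat_nth) (simp add: block_mat_def)
qed

lemma block_mat_zero: "k < length ds \<Longrightarrow> block_mat ds k (0\<^sub>m (ds ! k) (ds ! k)) = \<zero>\<^bsub>matrix_sum ds\<^esub>"
  by (simp add: block_mat_def matrix_sum_units list_update_same_conv)

text \<open>
  The idempotents are the diagonal matrix units of all blocks.  If column \<open>i\<close> of a block contains a
  nonzero entry \<open>c\<close> in row \<open>a\<close>, then \<open>c\<inverse>\<close> times the matrix unit at \<open>(i, a)\<close> moves that entry to the
  diagonal.
\<close>

lemma minimal_idempotents_matrix_sum:
  "minimal_idempotents (matrix_sum ds) (SIGMA k:{..<length ds}. {..<ds ! k})
     (\<lambda>(k, i). block_mat ds k (mat_unit (ds ! k) i i))"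
    (is "minimal_idempotents ?B ?I ?e")
proof -
  interpret ring ?B by (rule ring_matrix_sum)
  have e: "?e p \<in> carrier ?B" if "p \<in> ?I" for p
    using that by (auto intro: block_mat_carrier)
  have "?e p \<noteq> \<zero>\<^bsub>?B\<^esub>" if p: "p \<in> ?I" for p
  proof
    obtain k i where ki: "p = (k, i)" "k < length ds" "i < ds ! k" using p by auto
    assume "?e p = \<zero>\<^bsub>?B\<^esub>"
    then have "?e p ! k $$ (i, i) = \<zero>\<^bsub>?B\<^esub> ! k $$ (i, i)" by simp
    with ki show False by (simp add: block_mat_nth matrix_sum_units)
  qed
  moreover have "?e p \<otimes>\<^bsub>?B\<^esub> ?e q = \<zero>\<^bsub>?B\<^esub>" if p: "p \<in> ?I" and q: "q \<in> ?I" and "p \<noteq> q" for p q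
  proof -
    obtain k i l j where ki: "p = (k, i)" "k < length ds" "i < ds ! k"
      and lj: "q = (l, j)" "l < length ds" "j < ds ! l" using p q by auto
    have "?e p ! l * mat_unit (ds ! l) j j = 0\<^sub>m (ds ! l) (ds ! l)"
      using ki lj \<open>p \<noteq> q\<close>
      by (intro eq_matI) (auto simp: block_mat_nth mat_mult_unit_index simp del: index_mult_mat(1))
    then have "?e p \<otimes>\<^bsub>?B\<^esub> ?e q = block_mat ds l (0\<^sub>m (ds ! l) (ds ! l))"
      using e[OF p] lj by (simp add: mult_block_mat)
    also have "\<dots> = \<zero>\<^bsub>?B\<^esub>"
      by (rule block_mat_zero[OF lj(2)])
    finally show ?thesis .
  qed
  moreover have "(\<Oplus>\<^bsub>?B\<^esub>p\<in>?I. ?e p) = \<one>\<^bsub>?B\<^esub>"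
  proof (rule nth_equalityI)
    have s: "(\<Oplus>\<^bsub>?B\<^esub>p\<in>?I. ?e p) \<in> carrier ?B" using e by (intro finsum_closed) auto
    then show len: "length (\<Oplus>\<^bsub>?B\<^esub>p\<in>?I. ?e p) = length \<one>\<^bsub>?B\<^esub>"
      by (simp only: matrix_sum_carrier matrix_sum_units) simp
    fix k assume "k < length (\<Oplus>\<^bsub>?B\<^esub>p\<in>?I. ?e p)"
    then have k: "k < length ds" by (simp add: len matrix_sum_units)
    show "(\<Oplus>\<^bsub>?B\<^esub>p\<in>?I. ?e p) ! k = \<one>\<^bsub>?B\<^esub> ! k"
    proof (rule eq_matI)
      fix a b assume "a < dim_row (\<one>\<^bsub>?B\<^esub> ! k)" "b < dim_col (\<one>\<^bsub>?B\<^esub> ! k)"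
      then have ab: "a < ds ! k" "b < ds ! k" using k by (simp_all add: matrix_sum_units)
      have "(\<Oplus>\<^bsub>?B\<^esub>p\<in>?I. ?e p) ! k $$ (a, b) = (\<Sum>p\<in>?I. ?e p ! k $$ (a, b))"
        using e k ab by (intro matrix_sum_finsum_index) auto
      also have "\<dots> = (\<Sum>p\<in>?I. if p = (k, a) then if a = b then 1 else 0 else 0)"
        using k ab by (intro sum.cong) (auto simp: block_mat_nth split: if_splits)
      also have "\<dots> = \<one>\<^bsub>?B\<^esub> ! k $$ (a, b)"
        using k ab by (simp add: matrix_sum_units)
      finally show "(\<Oplus>\<^bsub>?B\<^esub>p\<in>?I. ?e p) ! k $$ (a, b) = \<one>\<^bsub>?B\<^esub> ! k $$ (a, b)" .
    qed (use s k in \<open>auto simp: matrix_sum_carrier matrix_sum_units\<close>)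
  qed
  moreover have "\<exists>y\<in>carrier ?B. y \<otimes>\<^bsub>?B\<^esub> (x \<otimes>\<^bsub>?B\<^esub> ?e p) = ?e p"
    if p: "p \<in> ?I" and x: "x \<in> carrier ?B" and nz: "x \<otimes>\<^bsub>?B\<^esub> ?e p \<noteq> \<zero>\<^bsub>?B\<^esub>" for p x
  proof -
    obtain k i where ki: "p = (k, i)" "k < length ds" "i < ds ! k" using p by auto
    let ?d = "ds ! k"
    have xk: "x ! k \<in> carrier_mat ?d ?d" using x ki by (simp add: matrix_sum_carrier)
    have xe: "x \<otimes>\<^bsub>?B\<^esub> ?e p = block_mat ds k (x ! k * mat_unit ?d i i)"
      using x ki by (simp add: mult_block_mat)
    have "\<exists>a<?d. x ! k $$ (a, i) \<noteq> 0"
    proof (rule ccontr)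
      assume "\<not> ?thesis"
      then have "x ! k * mat_unit ?d i i = 0\<^sub>m ?d ?d"
        using xk ki by (intro eq_matI) (auto simp: mat_mult_unit_index simp del: index_mult_mat(1))
      then have "x \<otimes>\<^bsub>?B\<^esub> ?e p = \<zero>\<^bsub>?B\<^esub>"
        by (simp only: xe block_mat_zero[OF ki(2)])
      with nz show False ..
    qed
    then obtain a where a: "a < ?d" "x ! k $$ (a, i) \<noteq> 0" by blast
    let ?y = "(1 / x ! k $$ (a, i)) \<cdot>\<^sub>m mat_unit ?d i a"
    have "?y * (x ! k * mat_unit ?d i i) = mat_unit ?d i i"
      using xk a ki
      by (intro eq_matI)
        (auto simp: mult_smult_assoc_mat[of _ ?d ?d _ ?d] mat_mult_unit_index simp del: index_mult_mat(1))
    then have "block_mat ds k ?y \<otimes>\<^bsub>?B\<^esub> (x \<otimes>\<^bsub>?B\<^esub> ?e p) = ?e p"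
      using xk ki unfolding xe
      by (subst mult_block_mat) (auto simp: block_mat_nth intro!: block_mat_carrier mult_carrier_mat)
    then show ?thesis using ki by (intro bexI) (auto intro: block_mat_carrier)
  qed
  ultimately show ?thesis using e by (auto simp: minimal_idempotents_def)
qed

section \<open>Small matrices\<close>

text \<open>
  With square matrices of size at most 3 written out by their entries, every identity between concrete
  matrices below is a matter of rewriting.
\<close>

definition mat1 :: "'a \<Rightarrow> 'a mat" where "mat1 a = mat (Suc 0) (Suc 0) (\<lambda>_. a)"
definition mat2 :: "'a \<Rightarrow> 'a \<Rightarrow> 'a \<Rightarrow> 'a \<Rightarrow> 'a mat" where
  "mat2 a b c d = mat_of_rows_list 2 [[a, b], [c, d]]"
definition mat3 :: "'a \<Rightarrow> 'a \<Rightarrow> 'a \<Rightarrow> 'a \<Rightarrow> 'a \<Rightarrow> 'a \<Rightarrow> 'a \<Rightarrow> 'a \<Rightarrow> 'a \<Rightarrow> 'a mat" where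
  "mat3 a b c d e f g h i = mat_of_rows_list 3 [[a, b, c], [d, e, f], [g, h, i]]"

text \<open>
  The index 1 is written \<open>Suc 0\<close> here and below because the simplifier normalizes it to that form.
\<close>

lemma mat1_simps:
  fixes a a' :: "'a::comm_ring_1"
  shows "mat1 a \<in> carrier_mat (Suc 0) (Suc 0)"
    "mat1 a * mat1 a' = mat1 (a * a')" "mat1 a + mat1 a' = mat1 (a + a')"
    "mat1 a - mat1 a' = mat1 (a - a')" "c \<cdot>\<^sub>m mat1 a = mat1 (c * a)"
    "0\<^sub>m (Suc 0) (Suc 0) = mat1 (0 :: 'a)" "1\<^sub>m (Suc 0) = mat1 (1 :: 'a)"
    "mat1 a $$ (0, 0) = a" "mat (Suc 0) (Suc 0) F = mat1 (F (0, 0))"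
  by (auto simp: mat1_def scalar_prod_def intro!: eq_matI)

lemma mat2_simps:
  fixes a b c d a' b' c' d' :: "'a::comm_ring_1"
  shows "mat2 a b c d \<in> carrier_mat 2 2"
    "mat2 a b c d * mat2 a' b' c' d' =
      mat2 (a * a' + b * c') (a * b' + b * d') (c * a' + d * c') (c * b' + d * d')"
    "mat2 a b c d + mat2 a' b' c' d' = mat2 (a + a') (b + b') (c + c') (d + d')"
    "mat2 a b c d - mat2 a' b' c' d' = mat2 (a - a') (b - b') (c - c') (d - d')"
    "x \<cdot>\<^sub>m mat2 a b c d = mat2 (x * a) (x * b) (x * c) (x * d)"
    "0\<^sub>m 2 2 = mat2 (0 :: 'a) 0 0 0" "1\<^sub>m 2 = mat2 (1 :: 'a) 0 0 1"
    "mat2 a b c d $$ (0, 0) = a" "mat2 a b c d $$ (0, Suc 0) = b"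
    "mat2 a b c d $$ (Suc 0, 0) = c" "mat2 a b c d $$ (Suc 0, Suc 0) = d"
    "mat 2 2 F = mat2 (F (0, 0)) (F (0, Suc 0)) (F (Suc 0, 0)) (F (Suc 0, Suc 0))"
  by (auto simp: mat2_def scalar_prod_def mat_of_rows_list_def less_Suc_eq numeral_2_eq_2 numeral_3_eq_3 intro!: eq_matI)

lemma mat3_simps:
  fixes a b c d e f g h i a' b' c' d' e' f' g' h' i' :: "'a::comm_ring_1"
  shows "mat3 a b c d e f g h i \<in> carrier_mat 3 3"
    "mat3 a b c d e f g h i * mat3 a' b' c' d' e' f' g' h' i' =
      mat3 (a * a' + b * d' + c * g') (a * b' + b * e' + c * h') (a * c' + b * f' + c * i')
           (d * a' + e * d' + f * g') (d * b' + e * e' + f * h') (d * c' + e * f' + f * i')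
           (g * a' + h * d' + i * g') (g * b' + h * e' + i * h') (g * c' + h * f' + i * i')"
    "mat3 a b c d e f g h i + mat3 a' b' c' d' e' f' g' h' i' =
      mat3 (a + a') (b + b') (c + c') (d + d') (e + e') (f + f') (g + g') (h + h') (i + i')"
    "mat3 a b c d e f g h i - mat3 a' b' c' d' e' f' g' h' i' =
      mat3 (a - a') (b - b') (c - c') (d - d') (e - e') (f - f') (g - g') (h - h') (i - i')"
    "x \<cdot>\<^sub>m mat3 a b c d e f g h i =
      mat3 (x * a) (x * b) (x * c) (x * d) (x * e) (x * f) (x * g) (x * h) (x * i)"
    "0\<^sub>m 3 3 = mat3 (0 :: 'a) 0 0 0 0 0 0 0 0" "1\<^sub>m 3 = mat3 (1 :: 'a) 0 0 0 1 0 0 0 1"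
    "mat3 a b c d e f g h i $$ (0, 0) = a" "mat3 a b c d e f g h i $$ (0, Suc 0) = b"
    "mat3 a b c d e f g h i $$ (0, 2) = c" "mat3 a b c d e f g h i $$ (Suc 0, 0) = d"
    "mat3 a b c d e f g h i $$ (Suc 0, Suc 0) = e" "mat3 a b c d e f g h i $$ (Suc 0, 2) = f"
    "mat3 a b c d e f g h i $$ (2, 0) = g" "mat3 a b c d e f g h i $$ (2, Suc 0) = h"
    "mat3 a b c d e f g h i $$ (2, 2) = i"
    "mat 3 3 F = mat3 (F (0, 0)) (F (0, Suc 0)) (F (0, 2)) (F (Suc 0, 0)) (F (Suc 0, Suc 0)) (F (Suc 0, 2))
       (F (2, 0)) (F (2, Suc 0)) (F (2, 2))"
  by (auto simp: mat3_def scalar_prod_def mat_of_rows_list_def less_Suc_eq numeral_2_eq_2 numeral_3_eq_3 intro!: eq_matI)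

lemmas small_mat_simps = mat1_simps mat2_simps mat3_simps

section \<open>The irreducible representations\<close>

text \<open>
  The two characters of \<open>S\<^sub>3\<close> and its two-dimensional representation, each extended in two ways to
  the ties, and the two representations induced from the group of order 2 that fixes one of the
  three partitions into two blocks.  The flag \<open>s\<close> selects the sign character (of \<open>S\<^sub>3\<close>, respectively
  of the group of order 2); the flag \<open>m\<close> says whether the ties act as 1 or as 0.
\<close>

datatype irrep = Character bool bool | Standard bool | Monomial bool

fun irrep_dim :: "irrep \<Rightarrow> nat" where
  "irrep_dim (Character s m) = 1"
| "irrep_dim (Standard m) = 2"
| "irrep_dim (Monomial s) = 3"

definition irreps :: "irrep list" where
  "irreps = [Character False False, Character True False, Character False True, Character True True,
     Standard False, Standard True, Monomial False, Monomial True]"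

definition sign :: "bool \<Rightarrow> 'a::ring_1" where "sign s = (if s then - 1 else 1)"

text \<open>
  The basis of the standard representation is \<open>v\<close>, \<open>T\<^sub>2 v\<close> with \<open>T\<^sub>1 v = v\<close> and \<open>v + T\<^sub>2 v + T\<^sub>1 T\<^sub>2 v = 0\<close>.  The
  basis of the monomial one is \<open>v\<close>, \<open>T\<^sub>2 v\<close>, \<open>T\<^sub>1 T\<^sub>2 v\<close> with \<open>T\<^sub>1 v = \<plusminus> v\<close>; the vectors belong to the
  partitions \<open>12|3\<close>, \<open>13|2\<close> and \<open>23|1\<close> in this order, and a tie fixes the vector of its
  partition and kills the other two.
\<close>

fun gen_mat :: "irrep \<Rightarrow> bt_gen \<Rightarrow> complex mat" where
  "gen_mat (Character s m) (Tgen i) = mat1 (sign s)"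
| "gen_mat (Character s m) (Egen i) = mat1 (of_bool m)"
| "gen_mat (Standard m) (Tgen I1) = mat2 1 (- 1) 0 (- 1)"
| "gen_mat (Standard m) (Tgen I2) = mat2 0 1 1 0"
| "gen_mat (Standard m) (Egen i) = mat2 (of_bool m) 0 0 (of_bool m)"
| "gen_mat (Monomial s) (Tgen I1) = mat3 (sign s) 0 0  0 0 1  0 1 0"
| "gen_mat (Monomial s) (Tgen I2) = mat3 0 1 0  1 0 0  0 0 (sign s)"
| "gen_mat (Monomial s) (Egen I1) = mat3 1 0 0  0 0 0  0 0 0"
| "gen_mat (Monomial s) (Egen I2) = mat3 0 0 0  0 0 0  0 0 1"

lemma gen_mat_carrier: "gen_mat k g \<in> carrier_mat (irrep_dim k) (irrep_dim k)"
  by (induction k g rule: gen_mat.induct) (simp_all add: small_mat_simps)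

definition rep :: "irrep \<Rightarrow> (bt_gen list \<Rightarrow>\<^sub>0 complex) \<Rightarrow> complex mat" where
  "rep k = matrix_rep (irrep_dim k) (gen_mat k)"

lemma rep_carrier [simp]: "rep k p \<in> carrier_mat (irrep_dim k) (irrep_dim k)"
  by (simp add: rep_def)

lemma rep_simps:
  "rep k (p + q) = rep k p + rep k q" "rep k (p * q) = rep k p * rep k q"
  "rep k (p - q) = rep k p - rep k q" "rep k 0 = 0\<^sub>m (irrep_dim k) (irrep_dim k)" "rep k 1 = 1\<^sub>m (irrep_dim k)"
  "rep k (gen g) = gen_mat k g" "rep k (Poly_Mapping.single 0 c) = c \<cdot>\<^sub>m 1\<^sub>m (irrep_dim k)"
  by (simp_all add: rep_def gen_mat_carrier matrix_rep_add matrix_rep_mult matrix_rep_diff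
      matrix_rep_0 matrix_rep_1 matrix_rep_gen matrix_rep_const)

lemma rep_relator:
  assumes "r \<in> bt_relators"
  shows "rep k r = 0\<^sub>m (irrep_dim k) (irrep_dim k)"
proof -
  have *: "(\<exists>i. R i) \<longleftrightarrow> R I1 \<or> R I2"
    "(\<exists>i j. Q i j \<and> i \<noteq> j) \<longleftrightarrow> Q I1 I2 \<or> Q I2 I1" for R and Q
    by (metis index.exhaust index.distinct)+
  show ?thesis
    using assms unfolding bt_relators_def
    by (cases k; simp only: Un_iff mem_Collect_eq * simp_thms insert_iff empty_iff; elim disjE)
      (simp_all add: rep_simps small_mat_simps power2_eq_square sign_def)
qed

section \<open>Seeds of the matrix units\<close>

text \<open>
  Up to the factor 6, the primitive central idempotent of a character of \<open>S\<^sub>3\<close>.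
\<close>

definition symmetrizer :: "'a::ring_1 \<Rightarrow> 'a \<Rightarrow> bool \<Rightarrow> 'a" where
  "symmetrizer t1 t2 s = (if s then 1 - t1 - t2 + t1 * t2 + t2 * t1 - t1 * t2 * t1
                      else 1 + t1 + t2 + t1 * t2 + t2 * t1 + t1 * t2 * t1)"

text \<open>
  The two idempotents fixed by \<open>S\<^sub>3\<close>: the join of all ties, and the Moebius inversion of the unit, which
  is killed by all ties.
\<close>

definition tie_part :: "'a::ring_1 \<Rightarrow> 'a \<Rightarrow> 'a \<Rightarrow> 'a \<Rightarrow> bool \<Rightarrow> 'a" where
  "tie_part t1 t2 e1 e2 m = (if m then e1 * e2 else 1 - e1 - e2 - t2 * e1 * t2 + e1 * e2 + e1 * e2)"

text \<open>
  The factor \<open>(1 + T\<^sub>1) (1 - T\<^sub>2 T\<^sub>1)\<close> is annihilated by both characters of \<open>S\<^sub>3\<close> and is represented by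
  3 times the matrix unit at \<open>(0, 0)\<close> in the standard representation.  The factor \<open>E\<^sub>1 - E\<^sub>1 E\<^sub>2\<close> is
  the idempotent of the partition \<open>12|3\<close>, whose stabilizer is generated by \<open>T\<^sub>1\<close>.  All coefficients
  are integers, so that the identities for seeds hold in every ring with braids and ties.
\<close>

fun seed :: "'a::ring_1 \<Rightarrow> 'a \<Rightarrow> 'a \<Rightarrow> 'a \<Rightarrow> irrep \<Rightarrow> 'a" where
  "seed t1 t2 e1 e2 (Character s m) = symmetrizer t1 t2 s * tie_part t1 t2 e1 e2 m"
| "seed t1 t2 e1 e2 (Standard m) = (1 + t1) * (1 - t2 * t1) * tie_part t1 t2 e1 e2 m"
| "seed t1 t2 e1 e2 (Monomial s) = (e1 - e1 * e2) * (if s then 1 - t1 else 1 + t1)"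

text \<open>
  The multiple of the matrix unit at \<open>(0, 0)\<close> by which the seed acts in its own representation; the
  seed divided by it is an idempotent.
\<close>

fun seed_coeff :: "irrep \<Rightarrow> nat" where
  "seed_coeff (Character s m) = 6" | "seed_coeff (Standard m) = 3" | "seed_coeff (Monomial s) = 2"

text \<open>
  The basis vectors of all eight representations are the translates of the first one by these
  elements of \<open>S\<^sub>3\<close>, as many of them as the dimension.
\<close>

definition transversal :: "'a::ring_1 \<Rightarrow> 'a \<Rightarrow> nat \<Rightarrow> 'a" where
  "transversal t1 t2 i = [1, t2, t1 * t2] ! i"
definition transversal_inv :: "'a::ring_1 \<Rightarrow> 'a \<Rightarrow> nat \<Rightarrow> 'a" where
  "transversal_inv t1 t2 i = [1, t2, t2 * t1] ! i"

lemma rep_seed: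
  "rep k (seed (genT I1) (genT I2) (genE I1) (genE I2) l) =
    (if k = l then of_nat (seed_coeff k) \<cdot>\<^sub>m mat_unit (irrep_dim k) 0 0 else 0\<^sub>m (irrep_dim k) (irrep_dim k))"
  by (cases k; cases l)
    (auto simp: rep_simps small_mat_simps sign_def symmetrizer_def tie_part_def mat_unit_def)

text \<open>
  Left multiplication by the \<open>i\<close>-th transversal element moves the first basis vector to the \<open>i\<close>-th
  one, and right multiplication by the inverse of the \<open>j\<close>-th does the same for the dual basis; so
  the matrix unit at \<open>(0, 0)\<close> becomes the one at \<open>(i, j)\<close>.
\<close>

lemma rep_matrix_unit:
  assumes "i < irrep_dim l" "j < irrep_dim l"
  shows "rep k (transversal (genT I1) (genT I2) i * seed (genT I1) (genT I2) (genE I1) (genE I2) l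
        * transversal_inv (genT I1) (genT I2) j) =
    (if k = l then of_nat (seed_coeff k) \<cdot>\<^sub>m mat_unit (irrep_dim k) i j else 0\<^sub>m (irrep_dim k) (irrep_dim k))"
proof (cases "k = l")
  case False
  then show ?thesis
    by (simp add: rep_simps(2) rep_seed right_mult_zero_mat[OF rep_carrier]
        left_mult_zero_mat[OF rep_carrier])
next
  case True
  have **: "i < Suc 0 \<longleftrightarrow> i = 0" "i < 2 \<longleftrightarrow> i = 0 \<or> i = Suc 0" "i < 3 \<longleftrightarrow> i = 0 \<or> i = Suc 0 \<or> i = 2" for i :: nat
    by auto
  show ?thesis
    unfolding rep_simps(2) rep_seed using assms True
    by (cases l) (auto simp: rep_simps small_mat_simps transversal_def transversal_inv_def mat_unit_def **)
qed

section \<open>Rewriting in a ring with braids and ties\<close>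

locale braids_ties =
  fixes t1 t2 e1 e2 :: "'a::ring_1"
  assumes braid: "t1 * t2 * t1 = t2 * t1 * t2"
    and idem: "e1 * e1 = e1" "e2 * e2 = e2"
    and ties_commute: "e1 * e2 = e2 * e1"
    and commute: "e1 * t1 = t1 * e1" "e2 * t2 = t2 * e2"
    and slide: "e2 * t1 * t2 = t1 * t2 * e1" "e1 * t2 * t1 = t2 * t1 * e2"
    and tie: "e1 * e2 * t2 = e1 * t2 * e1" "e2 * e1 * t1 = e2 * t1 * e2"
      "e1 * t2 * e1 = t2 * e1 * e2" "e2 * t1 * e2 = t1 * e2 * e1"
    and involution: "t1 * t1 = 1" "t2 * t2 = 1"
begin

text \<open>
  The third tie is the conjugate of the first; the slide relation says that it is equally
  a conjugate of the second.
\<close>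

definition e3 :: 'a where "e3 = t2 * e1 * t2"
definition e :: 'a where "e = e1 * e2"

lemma cancel: "t1 * (t1 * x) = x" "t2 * (t2 * x) = x"
  using involution by (simp_all flip: mult.assoc)

lemma e3_alt: "e3 = t1 * e2 * t1"
proof -
  have "t1 * e2 * t1 = t1 * (e2 * t1 * t2) * t2" by (simp add: mult.assoc involution)
  also have "\<dots> = e3" unfolding slide(1) by (simp add: e3_def mult.assoc cancel)
  finally show ?thesis ..
qed

lemma e_commute: "t1 * e = e * t1" "t2 * e = e * t2"
  using tie by (simp_all add: e_def mult.assoc ties_commute)

lemma e1_t2_e1: "e1 * (t2 * e1) = e * t2" and e2_t1_e2: "e2 * (t1 * e2) = e * t1"
  using tie by (simp_all add: e_def mult.assoc flip: ties_commute)

lemma e_idem: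
  "e1 * e = e" "e2 * e = e" "e * e1 = e" "e * e2 = e" "e * e = e"
proof -
  show *: "e1 * e = e" "e * e2 = e"
    by (simp_all add: e_def mult.assoc idem flip: mult.assoc[of e1 e1])
  show "e2 * e = e" by (metis e_def ties_commute mult.assoc idem(2))
  show "e * e1 = e" by (metis e_def ties_commute mult.assoc idem(1))
  then show "e * e = e" using * by (simp add: e_def flip: mult.assoc)
qed

lemma e3_products:
  "e1 * e3 = e" "e3 * e1 = e" "e2 * e3 = e" "e3 * e2 = e" "e3 * e3 = e3" "e * e3 = e" "e3 * e = e"
proof -
  show a: "e1 * e3 = e"
    by (metis e3_def e1_t2_e1 mult.assoc involution(2) mult_1_right)
  show b: "e3 * e1 = e"
    by (metis e3_def e1_t2_e1 e_commute(2) mult.assoc involution(2) mult_1_left)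
  show c: "e2 * e3 = e"
    by (metis e3_alt e2_t1_e2 mult.assoc involution(1) mult_1_right)
  show d: "e3 * e2 = e"
    by (metis e3_alt e2_t1_e2 e_commute(1) mult.assoc involution(1) mult_1_left)
  show "e3 * e3 = e3"
    unfolding e3_def by (simp add: mult.assoc cancel) (simp add: idem flip: mult.assoc)
  show "e * e3 = e" "e3 * e = e"
    by (metis a b c d e_def mult.assoc e_idem)+
qed

lemma move_ties:
  "t1 * e1 = e1 * t1" "t2 * e2 = e2 * t2" "t1 * e2 = e3 * t1" "t2 * e1 = e3 * t2"
  "t1 * e3 = e2 * t1" "t2 * e3 = e1 * t2"
proof -
  show "t1 * e2 = e3 * t1" "t1 * e3 = e2 * t1"
    by (simp_all add: e3_alt mult.assoc involution cancel)
  show "t2 * e1 = e3 * t2" "t2 * e3 = e1 * t2"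
    by (simp_all add: e3_def mult.assoc involution cancel)
qed (simp_all add: commute)

lemma braid': "t2 * (t1 * t2) = t1 * (t2 * t1)"
  using braid by (simp add: mult.assoc)

lemma fold_e: "e1 * e2 = e" "e2 * e1 = e"
  by (simp_all add: e_def ties_commute)

lemmas rewrite_rules = idem fold_e e_idem e3_products move_ties e_commute involution

lemma tail: "a * b = c \<Longrightarrow> a * (b * x) = c * x" for a b c x :: 'a
  by (simp flip: mult.assoc)

lemma braid_tail: "t2 * (t1 * (t2 * x)) = t1 * (t2 * (t1 * x))"
  using braid by (metis mult.assoc)

text \<open>
  Directed from left to right, these rules move ties in front of braids, multiply ties together, and
  shorten words in the \<open>T\<^sub>i\<close>.  The resulting normal forms are combinations of products of one of the
  five elements \<open>1\<close>, \<open>E\<^sub>1\<close>, \<open>E\<^sub>2\<close>, \<open>E\<^sub>3\<close>, \<open>E\<close> and one of the six elements of \<open>S\<^sub>3\<close>, so the identities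
  needed below are settled by rewriting.
\<close>

lemmas normal_form = mult.assoc rewrite_rules rewrite_rules[THEN tail] braid' braid_tail
  distrib_left distrib_right left_diff_distrib right_diff_distrib

lemma small_multiples: "2 * x = x + x" "3 * x = x + x + x" "6 * x = x + x + x + x + x + x" for x :: 'a
proof -
  have "3 * x = (2 + 1) * x" "6 * x = (2 * 2 + 2) * x" by simp_all
  then show "3 * x = x + x + x" "6 * x = x + x + x + x + x + x"
    by (simp_all only: distrib_right mult.assoc mult_2 mult_1_left add.assoc)
qed (rule mult_2)

lemma sum_less_3: "(\<Sum>i<3::nat. f i) = f 0 + f (Suc 0) + f 2" for f :: "nat \<Rightarrow> 'a"
  by (simp add: numeral_3_eq_3 numeral_2_eq_2)

lemma tie_part_eq: "tie_part t1 t2 e1 e2 m = (if m then e else 1 - e1 - e2 - e3 + e + e)"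
  by (simp add: tie_part_def e_def e3_def)

lemma tie_part_rules:
  "t1 * tie_part t1 t2 e1 e2 m = tie_part t1 t2 e1 e2 m * t1" "t2 * tie_part t1 t2 e1 e2 m = tie_part t1 t2 e1 e2 m * t2"
  "e1 * tie_part t1 t2 e1 e2 m = (if m then tie_part t1 t2 e1 e2 m else 0)"
  "e2 * tie_part t1 t2 e1 e2 m = (if m then tie_part t1 t2 e1 e2 m else 0)"
  by (simp_all add: tie_part_eq normal_form)

definition orbit_sum :: "irrep \<Rightarrow> 'a" where
  "orbit_sum k = (\<Sum>i<irrep_dim k. transversal t1 t2 i * seed t1 t2 e1 e2 k * transversal_inv t1 t2 i)"

text \<open>
  Up to the factor 6 and the central idempotent, this is the decomposition of the unit of the group
  algebra of \<open>S\<^sub>3\<close> into the central idempotents of its three irreducible representations.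
\<close>

lemma orbit_sum_tie_part:
  "orbit_sum (Character False m) + orbit_sum (Character True m) + 2 * orbit_sum (Standard m)
    = 6 * tie_part t1 t2 e1 e2 m"
  by (simp add: orbit_sum_def symmetrizer_def transversal_def transversal_inv_def normal_form small_multiples
      tie_part_rules(1,2) tie_part_rules(1,2)[THEN tail] numeral_2_eq_2)

text \<open>
  The two seeds add up to \<open>2 (E\<^sub>1 - E)\<close>, because their factors \<open>1 + T\<^sub>1\<close> and \<open>1 - T\<^sub>1\<close> add up to 2.
  The sum over the transversal then runs over the three conjugates \<open>E\<^sub>i - E\<close>.
\<close>

lemma orbit_sum_monomial:
  "orbit_sum (Monomial False) + orbit_sum (Monomial True) = 2 * (e1 + e2 + e3 - 3 * e)"
  by (simp add: orbit_sum_def transversal_def transversal_inv_def normal_form small_multiples sum_less_3)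

text \<open>
  The idempotents fixed by \<open>S\<^sub>3\<close> and the three \<open>E\<^sub>i - E\<close> add up to 1.  The weights make each seed
  contribute 6 times an idempotent.
\<close>

lemma orbit_sum_total: "(\<Sum>k\<leftarrow>irreps. of_nat (6 div seed_coeff k) * orbit_sum k) = 6"
proof -
  have "(\<Sum>k\<leftarrow>irreps. of_nat (6 div seed_coeff k) * orbit_sum k) =
     (orbit_sum (Character False False) + orbit_sum (Character True False) + 2 * orbit_sum (Standard False))
   + (orbit_sum (Character False True) + orbit_sum (Character True True) + 2 * orbit_sum (Standard True))
   + 3 * (orbit_sum (Monomial False) + orbit_sum (Monomial True))"
    by (simp add: irreps_def algebra_simps)
  also have "\<dots> = 6"
    unfolding orbit_sum_tie_part orbit_sum_monomial by (simp add: tie_part_eq algebra_simps small_multiples)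
  finally show ?thesis .
qed

fun generator :: "bt_gen \<Rightarrow> 'a" where
  "generator (Tgen I1) = t1" | "generator (Tgen I2) = t2"
| "generator (Egen I1) = e1" | "generator (Egen I2) = e2"

text \<open>
  The translates of a seed satisfy the same equations as the basis vectors in \<open>gen_mat\<close>.  Only the
  entries 0, 1 and -1 occur, so only these values of the scalar embedding matter.
\<close>

lemma generator_action:
  fixes scal :: "complex \<Rightarrow> 'a"
  assumes "scal 0 = 0" "scal 1 = 1" "scal (- 1) = - 1" and "i < irrep_dim k"
  shows "generator g * (transversal t1 t2 i * seed t1 t2 e1 e2 k) =
    (\<Sum>q<irrep_dim k. scal (gen_mat k g $$ (q, i)) * (transversal t1 t2 q * seed t1 t2 e1 e2 k))"
proof -
  show ?thesis
  proof (cases k)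
    case (Character s m)
    then show ?thesis using assms
      by (cases g rule: generator.cases)
       (auto simp: small_mat_simps symmetrizer_def sign_def transversal_def normal_form tie_part_rules tie_part_rules[THEN tail])
  next
    case (Standard m)
    then have "i = 0 \<or> i = Suc 0" using assms by auto
    then show ?thesis using assms Standard
      by (cases g rule: generator.cases)
       (auto simp: small_mat_simps transversal_def normal_form tie_part_rules tie_part_rules[THEN tail] numeral_2_eq_2)
  next
    case (Monomial s)
    then have "i = 0 \<or> i = Suc 0 \<or> i = 2" using assms by auto
    then show ?thesis using assms Monomial
      by (cases g rule: generator.cases)
       (auto simp: small_mat_simps sign_def transversal_def normal_form sum_less_3)
  qed
qed

end

section \<open>The homomorphism to the matrix algebras\<close>

definition all_reps :: "(bt_gen list \<Rightarrow>\<^sub>0 complex) \<Rightarrow> complex mat list" where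
  "all_reps p = map (\<lambda>k. rep k p) irreps"

abbreviation target :: "(complex, complex mat list) module" where
  "target \<equiv> matrix_sum (map irrep_dim irreps)"

lemma all_reps_carrier: "all_reps p \<in> carrier target"
  by (auto simp: all_reps_def matrix_sum_carrier)

lemma ring_hom_all_reps: "ring_hom_ring free_alg target all_reps"
proof (rule ring_hom_ringI)
  fix p q :: "bt_gen list \<Rightarrow>\<^sub>0 complex"
  show "all_reps (p \<otimes>\<^bsub>free_alg\<^esub> q) = all_reps p \<otimes>\<^bsub>target\<^esub> all_reps q"
    "all_reps (p \<oplus>\<^bsub>free_alg\<^esub> q) = all_reps p \<oplus>\<^bsub>target\<^esub> all_reps q"
    unfolding matrix_sum_ops[OF all_reps_carrier all_reps_carrier] free_alg_simps
    by (simp_all add: all_reps_def rep_simps map2_map_map)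
  show "all_reps \<one>\<^bsub>free_alg\<^esub> = \<one>\<^bsub>target\<^esub>"
    by (simp add: matrix_sum_units free_alg_simps all_reps_def rep_simps)
qed (auto simp: all_reps_carrier ring_free_alg ring_matrix_sum)

lemma all_reps_zero_iff:
  "all_reps p = \<zero>\<^bsub>target\<^esub> \<longleftrightarrow> (\<forall>k. rep k p = 0\<^sub>m (irrep_dim k) (irrep_dim k))"
proof -
  have "k \<in> set irreps" for k
    by (cases k) (auto simp: irreps_def)
  then show ?thesis by (auto simp: all_reps_def matrix_sum_units)
qed

lemma bt_ideal_subset_kernel: "bt_ideal \<subseteq> a_kernel free_alg target all_reps"
  unfolding bt_ideal_def
proof (rule ring.genideal_minimal[OF ring_free_alg ring_hom_ring.kernel_is_ideal[OF ring_hom_all_reps]])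
  show "bt_relators \<subseteq> a_kernel free_alg target all_reps"
    by (auto simp: a_kernel_def' free_alg_simps all_reps_zero_iff rep_relator)
qed

section \<open>The quotient ring\<close>

lemma bt_ideal_closed:
  "0 \<in> bt_ideal" "p \<in> bt_ideal \<Longrightarrow> q \<in> bt_ideal \<Longrightarrow> p + q \<in> bt_ideal"
  "p \<in> bt_ideal \<Longrightarrow> r * p \<in> bt_ideal" "p \<in> bt_ideal \<Longrightarrow> p * r \<in> bt_ideal"
  "p \<in> bt_ideal \<Longrightarrow> - p \<in> bt_ideal"
proof -
  interpret ideal bt_ideal "free_alg :: (complex, bt_gen list \<Rightarrow>\<^sub>0 complex) module"
    by (rule ideal_bt_ideal)
  show a: "p \<in> bt_ideal \<Longrightarrow> r * p \<in> bt_ideal" for p r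
    using I_l_closed[of p r] by (simp add: free_alg_simps)
  show "p \<in> bt_ideal \<Longrightarrow> - p \<in> bt_ideal"
    using a[of p "- 1"] by simp
  show "0 \<in> bt_ideal"
    using additive_subgroup.zero_closed[OF additive_subgroup_axioms] by (simp add: free_alg_simps)
  show "p \<in> bt_ideal \<Longrightarrow> q \<in> bt_ideal \<Longrightarrow> p + q \<in> bt_ideal"
    using additive_subgroup.a_closed[OF additive_subgroup_axioms, of p q] by (simp add: free_alg_simps)
  show "p \<in> bt_ideal \<Longrightarrow> p * r \<in> bt_ideal"
    using I_r_closed[of p r] by (simp add: free_alg_simps)
qed

lemma one_notin_bt_ideal: "1 \<notin> bt_ideal"
proof
  assume "1 \<in> bt_ideal"
  then have "rep (Character False False) 1 = 0\<^sub>m 1 1"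
    using bt_ideal_subset_kernel by (auto simp: a_kernel_def' all_reps_zero_iff)
  then have "rep (Character False False) 1 $$ (0, 0) = 0" by simp
  then show False by (simp add: rep_simps)
qed

text \<open>
  A second copy of the algebra, as a type: its operations are total and belong to the class of
  rings, so that the rewriting rules for braids and ties apply to it.
\<close>

quotient_type bt = "bt_gen list \<Rightarrow>\<^sub>0 complex" / "\<lambda>p q. p - q \<in> bt_ideal"
  morphisms bt_rep bt_class
proof (rule equivpI)
  show "reflp (\<lambda>p q. p - q \<in> bt_ideal)"
    by (simp add: reflp_def bt_ideal_closed)
  show "symp (\<lambda>p q. p - q \<in> bt_ideal)"
    using bt_ideal_closed(5) by (force simp: symp_def)
  show "transp (\<lambda>p q. p - q \<in> bt_ideal)"
    using bt_ideal_closed(2) by (force simp: transp_def)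
qed

instantiation bt :: ring_1
begin

lift_definition zero_bt :: bt is 0 .
lift_definition one_bt :: bt is 1 .
lift_definition plus_bt :: "bt \<Rightarrow> bt \<Rightarrow> bt" is "(+)"
  by (metis add_diff_add bt_ideal_closed(2))
lift_definition minus_bt :: "bt \<Rightarrow> bt \<Rightarrow> bt" is "(-)"
proof -
  fix p p' q q' :: "bt_gen list \<Rightarrow>\<^sub>0 complex"
  assume "p - p' \<in> bt_ideal" "q - q' \<in> bt_ideal"
  then have "(p - p') + - (q - q') \<in> bt_ideal" by (intro bt_ideal_closed)
  then show "p - q - (p' - q') \<in> bt_ideal" by (simp add: algebra_simps)
qed
lift_definition uminus_bt :: "bt \<Rightarrow> bt" is uminus
  using bt_ideal_closed(5) by fastforce
lift_definition times_bt :: "bt \<Rightarrow> bt \<Rightarrow> bt" is "(*)"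
proof -
  fix p p' q q' :: "bt_gen list \<Rightarrow>\<^sub>0 complex"
  assume "p - p' \<in> bt_ideal" "q - q' \<in> bt_ideal"
  then have "(p - p') * q + p' * (q - q') \<in> bt_ideal" by (intro bt_ideal_closed)
  then show "p * q - p' * q' \<in> bt_ideal" by (simp add: algebra_simps)
qed

instance
proof
  show "(0::bt) \<noteq> 1"
    using bt_ideal_closed(5)[of "- 1"] one_notin_bt_ideal by transfer auto
qed (transfer; simp add: algebra_simps bt_ideal_closed(1))+

end

lemmas bt_class_hom = zero_bt.abs_eq[symmetric] one_bt.abs_eq[symmetric] plus_bt.abs_eq[symmetric]
  minus_bt.abs_eq[symmetric] uminus_bt.abs_eq[symmetric] times_bt.abs_eq[symmetric]

lemma bt_class_eq_0_iff: "bt_class p = 0 \<longleftrightarrow> p \<in> bt_ideal"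
  unfolding zero_bt_def by (simp add: bt.abs_eq_iff)

definition bt_scalar :: "complex \<Rightarrow> bt" where
  "bt_scalar c = bt_class (Poly_Mapping.single 0 c)"

lemma bt_scalar_simps:
  "bt_scalar 0 = 0" "bt_scalar 1 = 1" "bt_scalar (a + b) = bt_scalar a + bt_scalar b"
  "bt_scalar (- a) = - bt_scalar a"
  by (simp_all add: bt_scalar_def bt_class_hom single_add single_uminus)

lemma bt_scalar_mult: "bt_scalar (a * b) = bt_scalar a * bt_scalar b"
  by (simp add: bt_scalar_def times_bt.abs_eq mult_single)

lemma bt_scalar_sum: "bt_scalar (\<Sum>i\<in>I. f i) = (\<Sum>i\<in>I. bt_scalar (f i))"
  by (induction I rule: infinite_finite_induct) (simp_all add: bt_scalar_simps)

lemma bt_scalar_commute: "x * bt_scalar c = bt_scalar c * x"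
proof (induction x rule: bt.abs_induct)
  case (1 p)
  have "Poly_Mapping.single 0 c * p = p * Poly_Mapping.single 0 c"
    by (induction p rule: poly_mapping_add_induct) (simp_all add: mult_single algebra_simps)
  then show ?case
    by (simp add: bt_scalar_def times_bt.abs_eq)
qed

lemma bt_class_relator: "r \<in> bt_relators \<Longrightarrow> bt_class r = 0"
  using ring.genideal_self[OF ring_free_alg, of bt_relators]
  by (auto simp: bt_class_eq_0_iff bt_ideal_def free_alg_simps)

interpretation bt: braids_ties "bt_class (genT I1)" "bt_class (genT I2)" "bt_class (genE I1)" "bt_class (genE I2)"
proof
  have neq: "I1 \<noteq> I2" "I2 \<noteq> I1" by simp_all
  have r: "bt_class p = bt_class q" if "p - q \<in> bt_relators" for p q
    using bt_class_relator[OF that] by (simp add: bt_class_hom)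
  show "bt_class (genT I1) * bt_class (genT I2) * bt_class (genT I1)
      = bt_class (genT I2) * bt_class (genT I1) * bt_class (genT I2)"
    "bt_class (genE I1) * bt_class (genE I2) = bt_class (genE I2) * bt_class (genE I1)"
    unfolding bt_class_hom[symmetric] by (rule r, unfold bt_relators_def, blast)+
  have "bt_class (genE i) * bt_class (genE i) = bt_class (genE i)"
    "bt_class (genE i) * bt_class (genT i) = bt_class (genT i) * bt_class (genE i)"
    "bt_class (genT i) * bt_class (genT i) = 1" for i
    unfolding bt_class_hom[symmetric] by (rule r, unfold bt_relators_def power2_eq_square, blast)+
  then show "bt_class (genE I1) * bt_class (genE I1) = bt_class (genE I1)"
    "bt_class (genE I2) * bt_class (genE I2) = bt_class (genE I2)"
    "bt_class (genE I1) * bt_class (genT I1) = bt_class (genT I1) * bt_class (genE I1)"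
    "bt_class (genE I2) * bt_class (genT I2) = bt_class (genT I2) * bt_class (genE I2)"
    "bt_class (genT I1) * bt_class (genT I1) = 1" "bt_class (genT I2) * bt_class (genT I2) = 1"
    by blast+
  have "bt_class (genE j) * bt_class (genT i) * bt_class (genT j)
      = bt_class (genT i) * bt_class (genT j) * bt_class (genE i)"
    "bt_class (genE i) * bt_class (genE j) * bt_class (genT j)
      = bt_class (genE i) * bt_class (genT j) * bt_class (genE i)"
    "bt_class (genE i) * bt_class (genT j) * bt_class (genE i)
      = bt_class (genT j) * bt_class (genE i) * bt_class (genE j)" if "i \<noteq> j" for i j
    unfolding bt_class_hom[symmetric] by (rule r, unfold bt_relators_def, use that in blast)+
  from this[OF neq(1)] this[OF neq(2)]
  show "bt_class (genE I2) * bt_class (genT I1) * bt_class (genT I2)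
      = bt_class (genT I1) * bt_class (genT I2) * bt_class (genE I1)"
    "bt_class (genE I1) * bt_class (genT I2) * bt_class (genT I1)
      = bt_class (genT I2) * bt_class (genT I1) * bt_class (genE I2)"
    "bt_class (genE I1) * bt_class (genE I2) * bt_class (genT I2)
      = bt_class (genE I1) * bt_class (genT I2) * bt_class (genE I1)"
    "bt_class (genE I2) * bt_class (genE I1) * bt_class (genT I1)
      = bt_class (genE I2) * bt_class (genT I1) * bt_class (genE I2)"
    "bt_class (genE I1) * bt_class (genT I2) * bt_class (genE I1)
      = bt_class (genT I2) * bt_class (genE I1) * bt_class (genE I2)"
    "bt_class (genE I2) * bt_class (genT I1) * bt_class (genE I2)
      = bt_class (genT I1) * bt_class (genE I2) * bt_class (genE I1)"
    by blast+
qed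

section \<open>The joint representation is an isomorphism\<close>

definition orbit_vector :: "irrep \<Rightarrow> nat \<Rightarrow> bt" where
  "orbit_vector k i = transversal (bt_class (genT I1)) (bt_class (genT I2)) i
     * seed (bt_class (genT I1)) (bt_class (genT I2)) (bt_class (genE I1)) (bt_class (genE I2)) k"

text \<open>
  The span of the translates of a seed is a copy of the representation: both sides are compatible with
  sums and products of \<open>p\<close>, so the case of generators suffices.
\<close>

lemma orbit_vector_action:
  assumes "i < irrep_dim k"
  shows "bt_class p * orbit_vector k i =
    (\<Sum>q<irrep_dim k. bt_scalar (rep k p $$ (q, i)) * orbit_vector k q)"
  using assms
proof (induction p arbitrary: i rule: free_alg_induct)
  case (const c)
  have "(\<Sum>q<irrep_dim k. bt_scalar (rep k (Poly_Mapping.single 0 c) $$ (q, i)) * orbit_vector k q) =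
     (\<Sum>q<irrep_dim k. if q = i then bt_scalar c * orbit_vector k q else 0)"
    using const by (intro sum.cong) (auto simp: rep_simps bt_scalar_simps)
  then show ?case using const by (simp add: bt_scalar_def)
next
  case (gen g)
  have "bt_class (gen g) = bt.generator g"
    by (cases g rule: bt.generator.cases) simp_all
  then show ?case
    using bt.generator_action[of bt_scalar i k g] gen
    by (simp add: orbit_vector_def bt_scalar_simps rep_simps)
next
  case (add p q)
  have "rep k (p + q) $$ (r, i) = rep k p $$ (r, i) + rep k q $$ (r, i)" if "r < irrep_dim k" for r
    using that add.prems carrier_matD[OF rep_carrier[of k q]] by (simp add: rep_simps)
  then show ?case
    using add by (simp add: bt_class_hom distrib_right sum.distrib bt_scalar_simps)
next
  case (mult p q)
  let ?d = "irrep_dim k"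
  have "bt_class (p * q) * orbit_vector k i
      = bt_class p * (\<Sum>r<?d. bt_scalar (rep k q $$ (r, i)) * orbit_vector k r)"
    using mult by (simp add: bt_class_hom mult.assoc)
  also have "\<dots> = (\<Sum>r<?d. bt_scalar (rep k q $$ (r, i)) * (bt_class p * orbit_vector k r))"
    by (simp add: sum_distrib_left bt_scalar_commute flip: mult.assoc)
  also have "\<dots> = (\<Sum>r<?d. \<Sum>t<?d. bt_scalar (rep k p $$ (t, r) * rep k q $$ (r, i)) * orbit_vector k t)"
    using mult by (simp add: sum_distrib_left bt_scalar_mult bt_scalar_commute[of "bt_scalar _"] flip: mult.assoc)
  also have "\<dots> = (\<Sum>t<?d. bt_scalar (\<Sum>r<?d. rep k p $$ (t, r) * rep k q $$ (r, i)) * orbit_vector k t)"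
    by (subst sum.swap) (simp add: bt_scalar_sum sum_distrib_right)
  also have "\<dots> = (\<Sum>t<?d. bt_scalar (rep k (p * q) $$ (t, i)) * orbit_vector k t)"
    using mult.prems carrier_matD[OF rep_carrier[of k]]
    by (intro sum.cong) (simp_all add: rep_simps scalar_prod_def atLeast0LessThan)
  finally show ?case .
qed

text \<open>
  Injectivity of the joint representation: an element that is represented by zero matrices annihilates
  all translates of seeds, hence annihilates the total orbit sum, which is the invertible scalar 6.
\<close>

lemma bt_class_eq_0:
  assumes "\<And>k. rep k p = 0\<^sub>m (irrep_dim k) (irrep_dim k)"
  shows "bt_class p = 0"
proof -
  have "bt_class p * orbit_vector k i = 0" if "i < irrep_dim k" for k i
    using that by (simp add: orbit_vector_action assms bt_scalar_simps)
  then have "bt_class p * bt.orbit_sum k = 0" for k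
    by (simp add: bt.orbit_sum_def sum_distrib_left flip: mult.assoc orbit_vector_def)
  then have "bt_class p * (\<Sum>k\<leftarrow>ks. of_nat (6 div seed_coeff k) * bt.orbit_sum k) = 0" for ks
    by (induction ks) (simp_all add: distrib_left mult_of_nat_commute mult.assoc flip: mult.assoc[of "bt_class p" "bt.orbit_sum _"])
  from this[of irreps] have 6: "bt_class p * 6 = 0"
    by (simp add: bt.orbit_sum_total)
  have "(6 :: bt) * bt_scalar (1 / 6) = 1"
  proof -
    have "bt_scalar 6 = 6"
      using bt_scalar_simps(3)[of 1 1] bt_scalar_simps(3)[of 2 1] bt_scalar_simps(3)[of 3 3]
      by (simp add: bt_scalar_simps)
    then show ?thesis
      using bt_scalar_mult[of 6 "1 / 6"] by (simp add: bt_scalar_simps)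
  qed
  then have "bt_class p = bt_class p * (6 * bt_scalar (1 / 6))" by simp
  also have "\<dots> = 0" using 6 by (simp flip: mult.assoc)
  finally show ?thesis .
qed

lemma kernel_all_reps: "a_kernel free_alg target all_reps = bt_ideal"
  using bt_ideal_subset_kernel bt_class_eq_0
  by (auto simp: a_kernel_def' all_reps_zero_iff simp flip: bt_class_eq_0_iff)

text \<open>
  Any choice of blocks is attained by the combination of the elements in \<open>rep_matrix_unit\<close> whose
  coefficients are the prescribed entries, divided by the multiples that occur there.
\<close>

lemma all_reps_surj: "all_reps ` carrier free_alg = carrier target"
proof
  show "all_reps ` carrier free_alg \<subseteq> carrier target"
    using all_reps_carrier by blast
  show "carrier target \<subseteq> all_reps ` carrier free_alg"
  proof
    fix xs assume xs: "xs \<in> carrier target"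
    define N where "N = length irreps"
    define d where "d m = irrep_dim (irreps ! m)" for m
    define U where "U = (\<lambda>(m, i, j). Poly_Mapping.single 0 (xs ! m $$ (i, j) / of_nat (seed_coeff (irreps ! m))) *
      (transversal (genT I1) (genT I2) i * seed (genT I1) (genT I2) (genE I1) (genE I2) (irreps ! m)
        * transversal_inv (genT I1) (genT I2) j))"
    define I where "I = (SIGMA m:{..<N}. {..<d m} \<times> {..<d m})"
    have c: "length xs = N" "\<And>m. m < N \<Longrightarrow> xs ! m \<in> carrier_mat (d m) (d m)"
      using xs by (auto simp: matrix_sum_carrier N_def d_def)
    have w: "seed_coeff k \<noteq> 0" for k by (cases k) auto
    have "rep (irreps ! m) (sum U I) = xs ! m" if m: "m < N" for m
    proof (rule eq_matI)
      fix a b assume "a < dim_row (xs ! m)" "b < dim_col (xs ! m)"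
      then have ab: "a < d m" "b < d m" using c(2)[OF m] by auto
      have "rep (irreps ! m) (U p) $$ (a, b) = (if p = (m, a, b) then xs ! m $$ (a, b) else 0)"
        if pI: "p \<in> I" for p
      proof -
        obtain l i j where p: "p = (l, i, j)" "l < N" "i < d l" "j < d l" using pI by (auto simp: I_def)
        have "irreps ! m = irreps ! l \<longleftrightarrow> m = l"
          using m p by (intro nth_eq_iff_index_eq) (auto simp: N_def irreps_def)
        then have "rep (irreps ! m) (U p) = (xs ! l $$ (i, j) / of_nat (seed_coeff (irreps ! l))) \<cdot>\<^sub>m
          (1\<^sub>m (d m) * (if m = l then of_nat (seed_coeff (irreps ! m)) \<cdot>\<^sub>m mat_unit (d m) i j else 0\<^sub>m (d m) (d m)))"
          using p rep_matrix_unit[of i "irreps ! l" j "irreps ! m"]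
          by (simp add: U_def rep_simps(2)[of _ "Poly_Mapping.single 0 _"] rep_simps(7) d_def mult_smult_assoc_mat[of _ "d m" "d m" _ "d m"])
        also have "1\<^sub>m (d m) * (if m = l then of_nat (seed_coeff (irreps ! m)) \<cdot>\<^sub>m mat_unit (d m) i j else 0\<^sub>m (d m) (d m))
          = (if m = l then of_nat (seed_coeff (irreps ! m)) \<cdot>\<^sub>m mat_unit (d m) i j else 0\<^sub>m (d m) (d m))"
          by (rule left_mult_one_mat[where nc = "d m"]) auto
        finally show ?thesis using ab p w by auto
      qed
      then have "(\<Sum>p\<in>I. rep (irreps ! m) (U p) $$ (a, b)) = (\<Sum>p\<in>I. if p = (m, a, b) then xs ! m $$ (a, b) else 0)"
        by (intro sum.cong) auto
      also have "\<dots> = xs ! m $$ (a, b)"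
        using m ab by (simp add: I_def)
      finally show "rep (irreps ! m) (sum U I) $$ (a, b) = xs ! m $$ (a, b)"
        using ab by (simp add: rep_def d_def I_def gen_mat_carrier matrix_rep_sum)
    qed (use c(2)[OF m] in \<open>auto simp: rep_def d_def\<close>)
    then have "all_reps (sum U I) = xs"
      using c by (intro nth_equalityI) (auto simp: all_reps_def N_def)
    then show "xs \<in> all_reps ` carrier free_alg" by (auto simp: free_alg_simps)
  qed
qed

lemma bt_alg_sel:
  "carrier bt_alg = carrier (free_alg Quot bt_ideal)"
  "monoid.mult bt_alg = monoid.mult (free_alg Quot bt_ideal)"
  "one bt_alg = one (free_alg Quot bt_ideal)"
  "zero bt_alg = zero (free_alg Quot bt_ideal)"
  "add bt_alg = add (free_alg Quot bt_ideal)"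
  by (simp_all add: bt_alg_def quotient_alg_def ring.defs module.defs)

lemma alg_iso_bt_alg: "(\<lambda>X. the_elem (all_reps ` X)) \<in> alg_iso bt_alg target"
proof -
  interpret \<Phi>: ring_hom_ring free_alg target all_reps
    by (rule ring_hom_all_reps)
  let ?h = "\<lambda>X. the_elem (all_reps ` X)"
  have "?h \<in> ring_iso (free_alg Quot bt_ideal) target"
    using \<Phi>.FactRing_iso_set[OF all_reps_surj] by (simp add: kernel_all_reps)
  then have iso: "?h \<in> ring_iso bt_alg target"
    by (simp add: ring_iso_def Ring.ring_hom_def bt_alg_sel)
  have h: "?h (bt_ideal +>\<^bsub>free_alg\<^esub> p) = all_reps p" for p
    using \<Phi>.the_elem_simp[of p] by (simp add: kernel_all_reps free_alg_simps)
  have "?h (c \<odot>\<^bsub>bt_alg\<^esub> X) = c \<odot>\<^bsub>target\<^esub> ?h X" if X: "X \<in> carrier bt_alg" for c X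
  proof -
    obtain p where p: "X = bt_ideal +>\<^bsub>free_alg\<^esub> p"
      using X by (auto simp: bt_alg_sel FactRing_def A_RCOSETS_def')
    have "all_reps (Poly_Mapping.single 0 c * p) = map (\<lambda>x. c \<cdot>\<^sub>m x) (all_reps p)"
    proof -
      have "rep k (Poly_Mapping.single 0 c * p) = c \<cdot>\<^sub>m rep k p" for k
        using mult_smult_assoc_mat[of "1\<^sub>m (irrep_dim k)" "irrep_dim k" "irrep_dim k" "rep k p" "irrep_dim k" c]
          left_mult_one_mat[OF rep_carrier[of k p]]
        by (simp add: rep_simps)
      then show ?thesis by (simp add: all_reps_def)
    qed
    then show ?thesis
      unfolding p smult_bt_alg h free_alg_simps(6)
      by (simp add: matrix_sum_smult all_reps_def)
  qed
  with iso show ?thesis by (simp add: alg_iso_def)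
qed

theorem theorem13:
  shows "semisimple_ring bt_alg \<and>
    alg_isomorphic bt_alg
      (direct_sum_alg (replicate 4 (matrix_alg 1) @ replicate 2 (matrix_alg 2) @ replicate 2 (matrix_alg 3)))"
proof
  let ?h = "\<lambda>X. the_elem (all_reps ` X)"
  have iso: "?h \<in> ring_iso bt_alg target"
    using alg_iso_bt_alg by (simp add: alg_iso_def)
  have "finite (SIGMA k:{..<length (map irrep_dim irreps)}. {..<map irrep_dim irreps ! k})" by simp
  with ring.semisimple_ring_of_minimal_idempotents[OF ring_bt_alg]
    minimal_idempotents_iso[OF ring_matrix_sum ring_bt_alg ring_iso_set_sym[OF ring_bt_alg iso] minimal_idempotents_matrix_sum]
  show "semisimple_ring bt_alg" by blast
  have "map irrep_dim irreps = replicate 4 1 @ replicate 2 2 @ replicate 2 3"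
    by (simp add: irreps_def numeral_eq_Suc)
  then have "target = direct_sum_alg (replicate 4 (matrix_alg 1) @ replicate 2 (matrix_alg 2) @ replicate 2 (matrix_alg 3))"
    by (simp add: matrix_sum_def)
  with alg_iso_bt_alg show "alg_isomorphic bt_alg
      (direct_sum_alg (replicate 4 (matrix_alg 1) @ replicate 2 (matrix_alg 2) @ replicate 2 (matrix_alg 3)))"
    by (auto simp: alg_isomorphic_def)
qed

end
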